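(* Let $G$ be an infinite bounded Abelian group and let $H$ be a countable (finite or infinite) subgroup of $G$. Then the following assertions are equivalent: (1) with $N=\exp(H)$, the group $G$ contains a subgroup of the form $\mathbb{Z}(N)^{(\omega)}$; (2) $H\in\mathcal{NRC}(G)$; (3) $H\in\mathcal{NR}(G)$.
   Context: $\exp G$ is the least common multiple of the orders of the elements of $G$; $G$ is bounded if $\exp G<\infty$. $\mathbb{Z}(N)$ is the cyclic group of order $N$ and $\mathbb{Z}(N)^{(\omega)}$ is the direct sum of countably infinitely many copies of it. For a topological Abelian group $X$, $X^\wedge$ is the group of continuous characters (continuous homomorphisms to the circle group), and $\mathbf{n}(X)=\bigcap_{\chi\in X^\wedge}\ker\chi$ is the von Neumann radical of $X$. For an infinite Abelian group $G$, $\mathcal{NR}(G)$ (respectively $\mathcal{NRC}(G)$) is the set of all subgroups $H$ of $G$ for which there exists a non-discrete Hausdorff (respectively complete non-discrete Hausdorff) group topology $\tau$ on $G$ with $\mathbf{n}(G,\tau)=H$. *)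

theory Defs
  imports "HOL-Analysis.Analysis" "HOL-Algebra.Multiplicative_Group" "HOL-Algebra.Product_Groups"
begin

text \<open>
  Both \<^const>\<open>group.ord\<close> and \<^const>\<open>Lcm\<close> on \<^typ>\<open>nat\<close> encode infinity by \<open>0\<close>: an element
  of infinite order has order \<open>0\<close>, and the least common multiple of an infinite set, or of a
  set containing \<open>0\<close>, is \<open>0\<close>. Hence \<open>group_exp G = 0\<close> means that the exponent is infinite.
\<close>

definition group_exp :: "('a, 'b) monoid_scheme \<Rightarrow> nat" where
  "group_exp G = Lcm (group.ord G ` carrier G)"

definition bounded_group :: "('a, 'b) monoid_scheme \<Rightarrow> bool" where
  "bounded_group G \<longleftrightarrow> group_exp G \<noteq> 0"

definition cyclic_group_power :: "nat \<Rightarrow> (nat \<Rightarrow> int) monoid" where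
  "cyclic_group_power N = sum_group (UNIV :: nat set) (\<lambda>_. integer_mod_group N)"

definition topological_abelian_group :: "('a, 'b) monoid_scheme \<Rightarrow> 'a topology \<Rightarrow> bool" where
  "topological_abelian_group G T \<longleftrightarrow>
     comm_group G \<and> topspace T = carrier G \<and>
     continuous_map (prod_topology T T) T (\<lambda>(x, y). x \<otimes>\<^bsub>G\<^esub> y) \<and>
     continuous_map T T (\<lambda>x. inv\<^bsub>G\<^esub> x)"

definition group_cauchy_filter ::
    "('a, 'b) monoid_scheme \<Rightarrow> 'a topology \<Rightarrow> 'a filter \<Rightarrow> bool" where
  "group_cauchy_filter G T F \<longleftrightarrow>
     F \<noteq> bot \<and> F \<le> principal (carrier G) \<and>
     (\<forall>U. openin T U \<and> \<one>\<^bsub>G\<^esub> \<in> U \<longrightarrow>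
        (\<forall>\<^sub>F (x, y) in F \<times>\<^sub>F F. x \<otimes>\<^bsub>G\<^esub> inv\<^bsub>G\<^esub> y \<in> U))"

text \<open>
  Completeness with respect to the group uniformity; since the groups are Abelian, the left and
  right uniformities coincide.
\<close>

definition complete_group_topology :: "('a, 'b) monoid_scheme \<Rightarrow> 'a topology \<Rightarrow> bool" where
  "complete_group_topology G T \<longleftrightarrow>
     (\<forall>F. group_cauchy_filter G T F \<longrightarrow> (\<exists>l. limitin T (\<lambda>x. x) l F))"

definition circle_group :: "complex monoid" where
  "circle_group = \<lparr>carrier = sphere 0 1, monoid.mult = (*), one = 1\<rparr>"

definition continuous_characters ::
    "('a, 'b) monoid_scheme \<Rightarrow> 'a topology \<Rightarrow> ('a \<Rightarrow> complex) set" where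
  "continuous_characters G T =
     {\<phi> \<in> hom G circle_group. continuous_map T (top_of_set (sphere 0 1)) \<phi>}"

definition von_neumann_radical :: "('a, 'b) monoid_scheme \<Rightarrow> 'a topology \<Rightarrow> 'a set" where
  "von_neumann_radical G T = (\<Inter>\<phi>\<in>continuous_characters G T. kernel G circle_group \<phi>)"

definition NR :: "('a, 'b) monoid_scheme \<Rightarrow> 'a set set" where
  "NR G = {H. subgroup H G \<and>
     (\<exists>T. topological_abelian_group G T \<and> Hausdorff_space T \<and>
          T \<noteq> discrete_topology (carrier G) \<and> von_neumann_radical G T = H)}"

definition NRC :: "('a, 'b) monoid_scheme \<Rightarrow> 'a set set" where
  "NRC G = {H. subgroup H G \<and>
     (\<exists>T. topological_abelian_group G T \<and> Hausdorff_space T \<and> complete_group_topology G T \<and>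
          T \<noteq> discrete_topology (carrier G) \<and> von_neumann_radical G T = H)}"

end

theory Submission
  imports Defs "HOL-Algebra.Free_Abelian_Groups" "HOL-Computational_Algebra.Primes"
begin

text \<open>
  Write \<open>N\<close> for the exponent of \<open>H\<close>. Every homomorphism from a bounded group to the circle takes
  values in a finite group of roots of unity, and such characters separate points from subgroups
  (\<open>exists_separating_character\<close>).

  \<^bold>\<open>A radical of exponent \<open>N\<close> forces a direct sum.\<close> If the group of \<open>m\<close>-th powers is finite, then in a
  Hausdorff group topology \<open>x \<mapsto> x\<^sup>m\<close> is trivial near the identity, so composing it with arbitrary characters
  gives enough continuous characters to show that the radical has exponent dividing \<open>m\<close>
  (\<open>radical_pow_eq_one\<close>). So if \<open>H\<close> is a radical and \<open>p\<^sup>a\<close> is a prime power exactly dividing \<open>N\<close>, the group of \<open>m\<close>-th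
  powers is infinite for \<open>m = q p\<^sup>a\<^sup>-\<^sup>1\<close>, where \<open>q\<close> is the part of the exponent of \<open>G\<close> prime to \<open>p\<close>. This infinite bounded
  \<open>p\<close>-group has infinite \<open>p\<close>-torsion, which means that elements of order \<open>p\<^sup>a\<close> can be found avoiding any
  finite subgroup (\<open>prime_power_rich_if_radical\<close>). Combining the primes and iterating yields
  infinitely many independent elements of order \<open>N\<close>
  (\<open>direct_sum_subgroup_if_prime_power_rich\<close>).

  \<^bold>\<open>A direct sum allows \<open>H\<close> to be a radical.\<close> For a sequence \<open>u\<close> consider the finest group topology
  in which \<open>u\<close> tends to the identity. It is always complete (\<open>complete_sequence_topology\<close>), and its
  continuous characters are those that kill some tail of \<open>u\<close>, so its radical is the intersection of
  the subgroups generated by the tails of \<open>u\<close> (\<open>von_neumann_radical_sequence_topology\<close>). It remains to find \<open>u\<close> such that this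
  intersection is \<open>H\<close> and the topology is Hausdorff. Let \<open>e\<close> be an independent sequence of elements
  of order \<open>N\<close>. It can be modified so that also \<open>H\<close> and the tails of \<open>e\<close> generate groups shrinking to \<open>H\<close>
  (\<open>independent_modulo_countable_subgroup\<close>). Then \<open>u\<close> is \<open>e\<close> interleaved with the elements \<open>h\<^sub>n b\<^sub>n\<close>,
  where \<open>h\<^sub>n\<close> runs through \<open>H\<close> hitting every element infinitely often and \<open>b\<^sub>n\<close> is the product of \<open>n + 1\<close> members of \<open>e\<close> far out.
  Each tail generates \<open>H\<close>, but to reach \<open>h\<^sub>n\<close> one needs more and more factors, and this keeps \<open>H\<close> away from small
  neighbourhoods of the identity (\<open>exists_null_sequence_with_radical\<close>).

  If \<open>H\<close> is trivial, \<open>N = 1\<close> provides no non-trivial sequence, and a prime \<open>p\<close> with infinite \<open>p\<close>-torsion takes the place of \<open>N\<close>.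
\<close>

section \<open>Exponents and generated subgroups\<close>

lemma group_exp_dvd_iff:
  assumes "group K"
  shows "group_exp K dvd m \<longleftrightarrow> (\<forall>x\<in>carrier K. x [^]\<^bsub>K\<^esub> m = \<one>\<^bsub>K\<^esub>)"
  using assms by (auto simp: group_exp_def Lcm_dvd_iff group.pow_eq_id)

context comm_group
begin

lemma generate_Un_iff:
  assumes "A \<subseteq> carrier G" "B \<subseteq> carrier G"
  shows "x \<in> generate G (A \<union> B) \<longleftrightarrow> (\<exists>a\<in>generate G A. \<exists>b\<in>generate G B. x = a \<otimes> b)"
proof
  have A: "subgroup (generate G A) G" and B: "subgroup (generate G B) G"
    using assms by (auto intro: generate_is_subgroup)
  note [simp] = subgroup.mem_carrier[OF A] subgroup.mem_carrier[OF B]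
  show "\<exists>a\<in>generate G A. \<exists>b\<in>generate G B. x = a \<otimes> b" if "x \<in> generate G (A \<union> B)"
    using that
  proof induction
    case one
    show ?case by (rule bexI[of _ \<one>], rule bexI[of _ \<one>]) (auto intro: generate.one)
  next
    case (incl h)
    then consider "h \<in> A" | "h \<in> B" by blast
    then show ?case
    proof cases
      case 1
      then show ?thesis using assms generate.incl[of h A G]
        by (intro bexI[of _ h] bexI[of _ \<one>]) (auto intro: generate.one)
    next
      case 2
      then show ?thesis using assms generate.incl[of h B G]
        by (intro bexI[of _ \<one>] bexI[of _ h]) (auto intro: generate.one)
    qed
  next
    case (inv h)
    then consider "h \<in> A" | "h \<in> B" by blast
    then show ?case
    proof cases
      case 1
      then show ?thesis using assms generate.inv[of h A G]
        by (intro bexI[of _ "inv h"] bexI[of _ \<one>]) (auto intro: generate.one)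
    next
      case 2
      then show ?thesis using assms generate.inv[of h B G]
        by (intro bexI[of _ \<one>] bexI[of _ "inv h"]) (auto intro: generate.one)
    qed
  next
    case (eng h1 h2)
    then obtain a b a' b' where *: "a \<in> generate G A" "b \<in> generate G B" "h1 = a \<otimes> b"
      "a' \<in> generate G A" "b' \<in> generate G B" "h2 = a' \<otimes> b'" by blast
    then have "h1 \<otimes> h2 = (a \<otimes> a') \<otimes> (b \<otimes> b')"
      by (simp add: m_ac)
    with * show ?case by (blast intro: generate.eng)
  qed
  have "generate G A \<subseteq> generate G (A \<union> B)" "generate G B \<subseteq> generate G (A \<union> B)"
    by (auto intro: mono_generate[THEN subsetD])
  then show "x \<in> generate G (A \<union> B)" if "\<exists>a\<in>generate G A. \<exists>b\<in>generate G B. x = a \<otimes> b"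
    using that by (auto intro: generate.eng)
qed

lemma generate_insert_iff:
  assumes "A \<subseteq> carrier G" "y \<in> carrier G"
  shows "x \<in> generate G (insert y A) \<longleftrightarrow> (\<exists>a\<in>generate G A. \<exists>c::int. x = a \<otimes> y [^] c)"
  using generate_Un_iff[of A "{y}" x] assms by (auto simp: generate_pow)

text \<open>
  Modulo the exponent, the new generator contributes only finitely many powers, so a bounded
  Abelian group is locally finite.
\<close>

lemma finite_generate:
  assumes "finite A" "A \<subseteq> carrier G" "M > 0" "\<And>x. x \<in> carrier G \<Longrightarrow> x [^] (M::nat) = \<one>"
  shows "finite (generate G A)"
  using assms(1,2)
proof (induction A)
  case empty
  then show ?case by (simp add: generate_empty)
next
  case (insert y A)
  have "generate G (insert y A) \<subseteq> (\<lambda>(a, c). a \<otimes> y [^] c) ` (generate G A \<times> {0..<int M})"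
  proof
    fix x assume "x \<in> generate G (insert y A)"
    then obtain a and c :: int where a: "a \<in> generate G A" and x: "x = a \<otimes> y [^] c"
      using insert.prems by (auto simp: generate_insert_iff)
    have y: "y [^] int M = \<one>" "y \<in> carrier G"
      using insert.prems assms(4) by (auto simp: int_pow_int)
    have "y [^] c = y [^] (int M * (c div int M) + c mod int M)" by simp
    also have "\<dots> = (y [^] int M) [^] (c div int M) \<otimes> y [^] (c mod int M)"
      using y(2) by (simp only: int_pow_mult int_pow_pow)
    finally have "y [^] c = y [^] (c mod int M)" using y by simp
    with a x \<open>M > 0\<close> show "x \<in> (\<lambda>(a, c). a \<otimes> y [^] c) ` (generate G A \<times> {0..<int M})"
      by (intro image_eqI[of _ _ "(a, c mod int M)"]) auto
  qed
  moreover have "finite (generate G A \<times> {0..<int M})"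
    using insert by simp
  ultimately show ?case by (meson finite_imageI finite_subset)
qed

lemma generate_finite_support:
  assumes "x \<in> generate G (f ` I)"
  shows "\<exists>J. finite J \<and> J \<subseteq> I \<and> x \<in> generate G (f ` J)"
  using assms
proof induction
  case one
  show ?case by (rule exI[of _ "{}"]) (auto intro: generate.one)
next
  case (incl h)
  then obtain i where "i \<in> I" "h = f i" by blast
  then show ?case by (intro exI[of _ "{i}"]) (auto intro: generate.incl)
next
  case (inv h)
  then obtain i where "i \<in> I" "h = f i" by blast
  then show ?case by (intro exI[of _ "{i}"]) (auto intro: generate.inv)
next
  case (eng h1 h2)
  then obtain J1 J2 where *: "finite J1" "J1 \<subseteq> I" "h1 \<in> generate G (f ` J1)"
    "finite J2" "J2 \<subseteq> I" "h2 \<in> generate G (f ` J2)" by blast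
  have "generate G (f ` J1) \<subseteq> generate G (f ` (J1 \<union> J2))"
    "generate G (f ` J2) \<subseteq> generate G (f ` (J1 \<union> J2))"
    by (auto intro!: mono_generate)
  with * show ?case by (intro exI[of _ "J1 \<union> J2"]) (auto intro: generate.eng)
qed

end

section \<open>Characters\<close>

lemma comm_group_circle_group: "comm_group circle_group"
  unfolding circle_group_def
proof (rule comm_groupI)
  fix x :: complex assume "x \<in> carrier \<lparr>carrier = sphere 0 1, monoid.mult = (*), one = 1\<rparr>"
  then show "\<exists>y\<in>carrier \<lparr>carrier = sphere 0 1, monoid.mult = (*), one = 1\<rparr>.
      y \<otimes>\<^bsub>\<lparr>carrier = sphere 0 1, monoid.mult = (*), one = 1\<rparr>\<^esub> x = \<one>\<^bsub>\<lparr>carrier = sphere 0 1, monoid.mult = (*), one = 1\<rparr>\<^esub>"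
    by (intro bexI[of _ "inverse x"]) (auto simp: norm_inverse intro!: left_inverse)
qed (auto simp: norm_mult)

lemma circle_group_simps [simp]:
  "carrier circle_group = sphere 0 1" "x \<otimes>\<^bsub>circle_group\<^esub> y = x * y" "\<one>\<^bsub>circle_group\<^esub> = 1"
  by (simp_all add: circle_group_def)

lemma circle_group_pow: "x [^]\<^bsub>circle_group\<^esub> (n::nat) = x ^ n"
  using comm_group_circle_group by (induction n) (auto simp: nat_pow_def)

text \<open>
  The circle is divisible, and a \<open>d\<close>-th root can be chosen different from \<open>1\<close> even when \<open>v = 1\<close>.
  The second clause is what makes an extended character separate a prescribed point.
\<close>

lemma root_on_circle_neq_1:
  assumes "norm v = 1" "d \<ge> 2"
  shows "\<exists>w::complex. norm w = 1 \<and> w ^ d = v \<and> w \<noteq> 1"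
proof (cases "v = 1")
  case True
  have "cis (2 * pi / real d) ^ d = 1"
  proof -
    have "real d * (2 * pi / real d) = 2 * pi" using assms(2) by simp
    then show ?thesis by (simp only: Complex.DeMoivre cis_2pi)
  qed
  moreover have "cis (2 * pi / real d) \<noteq> 1"
  proof
    assume "cis (2 * pi / real d) = 1"
    then have "cos (2 * pi / real d) = 1" by (metis cis.simps(1) one_complex.simps(1))
    moreover have "cos (2 * pi / real d) < cos 0"
    proof (rule cos_monotone_0_pi)
      have "2 * pi / real d \<le> 2 * pi / 2"
        using assms(2) by (intro divide_left_mono) auto
      then show "2 * pi / real d \<le> pi" by simp
    qed (use assms(2) in auto)
    ultimately show False by simp
  qed
  ultimately show ?thesis using True by (intro exI[of _ "cis (2 * pi / real d)"]) simp
next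
  case False
  have "v = cis (Arg v)" using assms(1) rcis_cmod_Arg[of v] by (simp add: rcis_def)
  moreover have "cis (Arg v / real d) ^ d = cis (Arg v)"
    using assms(2) by (simp add: Complex.DeMoivre)
  ultimately show ?thesis using False
    by (intro exI[of _ "cis (Arg v / real d)"]) auto
qed

context comm_group
begin

text \<open>
  The graph of a character of a subgroup, namely of the domain of \<open>\<Gamma>\<close>. Working with graphs makes
  unions of chains immediate. In a bounded group inverses are powers, so closure under products gives
  closure under inverses, and then uniqueness of the value at \<open>\<one>\<close> gives uniqueness everywhere.
\<close>

definition partial_character :: "('a \<times> complex) set \<Rightarrow> bool" where
  "partial_character \<Gamma> \<longleftrightarrow> \<Gamma> \<subseteq> carrier G \<times> sphere 0 1 \<and> (\<one>, 1) \<in> \<Gamma> \<and>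
     (\<forall>a z b w. (a, z) \<in> \<Gamma> \<longrightarrow> (b, w) \<in> \<Gamma> \<longrightarrow> (a \<otimes> b, z * w) \<in> \<Gamma>) \<and>
     (\<forall>z. (\<one>, z) \<in> \<Gamma> \<longrightarrow> z = 1)"

lemma partial_character_pow:
  assumes "partial_character \<Gamma>" "(a, z) \<in> \<Gamma>"
  shows "(a [^] (n::nat), z ^ n) \<in> \<Gamma>"
proof (induction n)
  case 0
  then show ?case using assms by (simp add: partial_character_def)
next
  case (Suc n)
  then have "(a [^] n \<otimes> a, z ^ n * z) \<in> \<Gamma>"
    using assms by (simp add: partial_character_def)
  then show ?case by (simp add: mult.commute)
qed

text \<open>
  If \<open>d\<close> is the least positive exponent that brings \<open>y\<close> into the domain, then sending \<open>y\<close> to any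
  \<open>d\<close>-th root \<open>w\<close> of the value at \<open>y\<^sup>d\<close> is consistent, because all exponents bringing \<open>y\<close> into the
  domain are multiples of \<open>d\<close>. Since \<open>d \<ge> 2\<close>, the root can be chosen different from \<open>1\<close>.
\<close>

lemma partial_character_extend:
  assumes exp: "M > 0" "\<And>x. x \<in> carrier G \<Longrightarrow> x [^] (M::nat) = \<one>"
    and \<Gamma>: "partial_character \<Gamma>" and y: "y \<in> carrier G" "y \<notin> Domain \<Gamma>"
  shows "\<exists>\<Gamma>' w. partial_character \<Gamma>' \<and> \<Gamma> \<subseteq> \<Gamma>' \<and> (y, w) \<in> \<Gamma>' \<and> w \<noteq> 1"
proof -
  note mult = \<Gamma>[unfolded partial_character_def, THEN conjunct2, THEN conjunct2, THEN conjunct1, rule_format]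
  note pow = partial_character_pow[OF \<Gamma>]
  have carr: "a \<in> carrier G" "norm z = 1" if "(a, z) \<in> \<Gamma>" for a z
    using \<Gamma> that by (auto simp: partial_character_def)
  have one: "(\<one>, 1) \<in> \<Gamma>" and single: "z = 1" if "(\<one>, z) \<in> \<Gamma>" for z
    using \<Gamma> that by (auto simp: partial_character_def)
  have one: "(\<one>, 1) \<in> \<Gamma>" using \<Gamma> by (auto simp: partial_character_def)
  define d where "d = (LEAST i::nat. i > 0 \<and> y [^] i \<in> Domain \<Gamma>)"
  have "M > 0 \<and> y [^] M \<in> Domain \<Gamma>" using exp y one by auto
  then have d: "d > 0 \<and> y [^] d \<in> Domain \<Gamma>"
    unfolding d_def by (rule LeastI[where P = "\<lambda>i::nat. i > 0 \<and> y [^] i \<in> Domain \<Gamma>"])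
  have least: "i = 0" if "y [^] i \<in> Domain \<Gamma>" "i < d" for i :: nat
    using not_less_Least[of i "\<lambda>i::nat. i > 0 \<and> y [^] i \<in> Domain \<Gamma>"] that d_def by auto
  have "d \<noteq> 1" using d y by auto
  then have "d \<ge> 2" using d by linarith
  obtain v where v: "(y [^] d, v) \<in> \<Gamma>" using d by blast
  obtain w where w: "norm w = 1" "w ^ d = v" "w \<noteq> 1"
    using root_on_circle_neq_1[OF carr(2)[OF v] \<open>d \<ge> 2\<close>] by blast
  have dvd: "d dvd i" if i: "y [^] i \<in> Domain \<Gamma>" for i :: nat
  proof -
    obtain z where z: "(y [^] i, z) \<in> \<Gamma>" using i by blast
    \<comment> \<open>The exponent M - 1 plays the role of -1: this is the power of y to the i mod d.\<close>
    have "(y [^] i \<otimes> (y [^] d) [^] (i div d * (M - 1)), z * v ^ (i div d * (M - 1))) \<in> \<Gamma>"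
      by (intro mult z pow v)
    moreover have "y [^] i \<otimes> (y [^] d) [^] (i div d * (M - 1)) = y [^] (i mod d)"
    proof -
      have "i + d * (i div d * (M - 1)) = i mod d + (d * (i div d) + d * (i div d) * (M - 1))"
        by (metis add.assoc mod_mult_div_eq mult.assoc)
      also have "d * (i div d) + d * (i div d) * (M - 1) = d * (i div d) * M"
        using exp(1) by (cases M) simp_all
      finally have "i + d * (i div d * (M - 1)) = i mod d + M * (d * (i div d))"
        by (simp only: mult.commute)
      then have "y [^] i \<otimes> (y [^] d) [^] (i div d * (M - 1)) = y [^] (i mod d) \<otimes> (y [^] M) [^] (d * (i div d))"
        using y(1) by (simp only: nat_pow_pow nat_pow_mult)
      then show ?thesis using y exp by simp
    qed
    ultimately have "y [^] (i mod d) \<in> Domain \<Gamma>" by auto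
    then have "i mod d = 0" using least d by simp
    then show ?thesis by auto
  qed
  define \<Gamma>' where "\<Gamma>' = {(a \<otimes> y [^] i, z * w ^ i) |a z i. (a, z) \<in> \<Gamma> \<and> i \<in> (UNIV::nat set)}"
  have \<Gamma>'I: "(a \<otimes> y [^] i, z * w ^ i) \<in> \<Gamma>'" if "(a, z) \<in> \<Gamma>" for a z and i :: nat
    using that by (auto simp: \<Gamma>'_def)
  have "partial_character \<Gamma>'"
    unfolding partial_character_def
  proof (intro conjI allI impI)
    show "\<Gamma>' \<subseteq> carrier G \<times> sphere 0 1"
      using carr y w by (auto simp: \<Gamma>'_def norm_mult norm_power)
    show "(\<one>, 1) \<in> \<Gamma>'" using \<Gamma>'I[OF one, of 0] by simp
  next
    fix a z b u assume "(a, z) \<in> \<Gamma>'" "(b, u) \<in> \<Gamma>'"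
    then obtain a' z' i b' u' j where *: "(a', z') \<in> \<Gamma>" "(b', u') \<in> \<Gamma>"
      "a = a' \<otimes> y [^] (i::nat)" "z = z' * w ^ i" "b = b' \<otimes> y [^] (j::nat)" "u = u' * w ^ j"
      by (auto simp: \<Gamma>'_def)
    have "((a' \<otimes> b') \<otimes> y [^] (i + j), (z' * u') * w ^ (i + j)) \<in> \<Gamma>'"
      using * by (intro \<Gamma>'I mult)
    moreover have "(a' \<otimes> b') \<otimes> y [^] (i + j) = a \<otimes> b"
      using * y carr by (simp add: m_ac flip: nat_pow_mult)
    moreover have "(z' * u') * w ^ (i + j) = z * u"
      using * by (simp add: power_add)
    ultimately show "(a \<otimes> b, z * u) \<in> \<Gamma>'" by simp
  next
    fix z assume "(\<one>, z) \<in> \<Gamma>'"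
    then obtain a z' i where *: "(a, z') \<in> \<Gamma>" "\<one> = a \<otimes> y [^] (i::nat)" "z = z' * w ^ i"
      by (auto simp: \<Gamma>'_def)
    have a: "a \<in> carrier G" using carr * by blast
    have "a \<otimes> a [^] (M - 1) = a [^] M"
      using a exp(1) nat_pow_Suc2[of a "M - 1"] by simp
    then have "a \<otimes> a [^] (M - 1) = a \<otimes> y [^] i" using * a exp by simp
    then have "y [^] i = a [^] (M - 1)" using a y by simp
    then have "y [^] i \<in> Domain \<Gamma>" using pow[OF *(1)] by auto
    then obtain t where t: "i = d * t" using dvd by blast
    have "(a \<otimes> (y [^] d) [^] t, z' * v ^ t) \<in> \<Gamma>"
      by (intro mult * pow v)
    then have "(\<one>, z) \<in> \<Gamma>" using * t w y by (simp add: nat_pow_pow power_mult)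
    then show "z = 1" by (rule single)
  qed
  moreover have "\<Gamma> \<subseteq> \<Gamma>'"
    using \<Gamma>'I[of _ _ 0] carr by fastforce
  moreover have "(y, w) \<in> \<Gamma>'"
    using \<Gamma>'I[OF one, of 1] y by simp
  ultimately show ?thesis using w by blast
qed

text \<open>
  Start from the trivial character on \<open>H\<close>, extend it by one step to \<open>x\<close> with a value different from
  \<open>1\<close>, and take a maximal further extension. By the extension lemma its domain is the whole group.
\<close>

proposition exists_separating_character:
  assumes exp: "M > 0" "\<And>x. x \<in> carrier G \<Longrightarrow> x [^] (M::nat) = \<one>"
    and H: "subgroup H G" and x: "x \<in> carrier G" "x \<notin> H"
  shows "\<exists>\<phi>\<in>hom G circle_group. (\<forall>h\<in>H. \<phi> h = 1) \<and> \<phi> x \<noteq> 1"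
proof -
  have "partial_character (H \<times> {1})"
    using subgroup.subset[OF H] H
    by (auto simp: partial_character_def subgroup.one_closed subgroup.m_closed)
  with partial_character_extend[OF exp this x(1)] x(2) obtain \<Gamma>0 w where
    \<Gamma>0: "partial_character \<Gamma>0" "H \<times> {1} \<subseteq> \<Gamma>0" "(x, w) \<in> \<Gamma>0" "w \<noteq> 1" by auto
  define \<A> where "\<A> = {\<Gamma>. partial_character \<Gamma> \<and> \<Gamma>0 \<subseteq> \<Gamma>}"
  have "\<exists>\<Gamma>\<in>\<A>. \<forall>\<Delta>\<in>\<A>. \<Gamma> \<subseteq> \<Delta> \<longrightarrow> \<Delta> = \<Gamma>"
  proof (rule subset_Zorn_nonempty)
    show "\<A> \<noteq> {}" using \<Gamma>0 by (auto simp: \<A>_def)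
  next
    fix \<C> assume \<C>: "\<C> \<noteq> {}" "subset.chain \<A> \<C>"
    then have sub: "\<C> \<subseteq> \<A>" by (simp add: subset_chain_def)
    have pc: "partial_character \<Delta>" if "\<Delta> \<in> \<C>" for \<Delta>
      using that sub by (auto simp: \<A>_def)
    show "\<Union>\<C> \<in> \<A>"
      unfolding \<A>_def mem_Collect_eq partial_character_def
    proof (intro conjI allI impI)
      fix a z b u assume "(a, z) \<in> \<Union>\<C>" "(b, u) \<in> \<Union>\<C>"
      then obtain \<Delta> where "\<Delta> \<in> \<C>" "(a, z) \<in> \<Delta>" "(b, u) \<in> \<Delta>"
        using \<C>(2) unfolding subset_chain_def by blast
      moreover have "partial_character \<Delta>" using \<open>\<Delta> \<in> \<C>\<close> sub by (auto simp: \<A>_def)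
      ultimately show "(a \<otimes> b, z * u) \<in> \<Union>\<C>"
        unfolding partial_character_def by blast
    next
      obtain \<Delta> where "\<Delta> \<in> \<C>" using \<C>(1) by blast
      with sub show "(\<one>, 1) \<in> \<Union>\<C>" "\<Gamma>0 \<subseteq> \<Union>\<C>"
        by (auto simp: \<A>_def partial_character_def)
    next
      show "\<Union>\<C> \<subseteq> carrier G \<times> sphere 0 1"
        using pc unfolding partial_character_def by blast
      show "z = 1" if "(\<one>, z) \<in> \<Union>\<C>" for z
        using pc that unfolding partial_character_def by blast
    qed
  qed
  then obtain \<Gamma> where "\<Gamma> \<in> \<A>" and max': "\<forall>\<Delta>\<in>\<A>. \<Gamma> \<subseteq> \<Delta> \<longrightarrow> \<Delta> = \<Gamma>"
    by (rule bexE)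
  then have \<Gamma>: "partial_character \<Gamma>" "\<Gamma>0 \<subseteq> \<Gamma>" by (simp_all add: \<A>_def)
  have max: "\<Delta> = \<Gamma>" if "partial_character \<Delta>" "\<Gamma> \<subseteq> \<Delta>" for \<Delta>
    using max' that \<Gamma>(2) by (simp add: \<A>_def)
  have total: "y \<in> Domain \<Gamma>" if y: "y \<in> carrier G" for y
  proof (rule ccontr)
    assume "y \<notin> Domain \<Gamma>"
    then obtain \<Delta> w where \<Delta>: "partial_character \<Delta>" "\<Gamma> \<subseteq> \<Delta>" "(y, w) \<in> \<Delta>"
      using partial_character_extend[OF exp \<Gamma>(1) y] by metis
    then have "(y, w) \<in> \<Gamma>" using max[OF \<Delta>(1,2)] by simp
    with \<open>y \<notin> Domain \<Gamma>\<close> show False by (auto intro: DomainI)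
  qed
  have mult: "(a \<otimes> b, z * u) \<in> \<Gamma>" if "(a, z) \<in> \<Gamma>" "(b, u) \<in> \<Gamma>" for a z b u
    using \<Gamma>(1) that by (simp add: partial_character_def)
  have single: "z = u" if "(a, z) \<in> \<Gamma>" "(a, u) \<in> \<Gamma>" for a z u
  proof -
    have a: "a \<in> carrier G" and u: "u \<noteq> 0" using \<Gamma>(1) that by (auto simp: partial_character_def)
    have M: "a \<otimes> a [^] (M - 1) = \<one>"
      using a exp nat_pow_Suc2[of a "M - 1"] by simp
    have "(a \<otimes> a [^] (M - 1), b * u ^ (M - 1)) \<in> \<Gamma>" if "(a, b) \<in> \<Gamma>" for b
      by (intro mult that partial_character_pow[OF \<Gamma>(1)] \<open>(a, u) \<in> \<Gamma>\<close>)
    then have "b * u ^ (M - 1) = 1" if "(a, b) \<in> \<Gamma>" for b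
      using M \<Gamma>(1) that unfolding partial_character_def by metis
    then have "z * u ^ (M - 1) = u * u ^ (M - 1)" using that by simp
    then show ?thesis using u by simp
  qed
  define \<phi> where "\<phi> a = (THE z. (a, z) \<in> \<Gamma>)" for a
  have \<phi>: "\<phi> a = z" if "(a, z) \<in> \<Gamma>" for a z
    unfolding \<phi>_def by (intro the_equality that) (rule single[OF _ that])
  have \<phi>': "(a, \<phi> a) \<in> \<Gamma>" if "a \<in> carrier G" for a
  proof -
    obtain z where z: "(a, z) \<in> \<Gamma>" using total[OF \<open>a \<in> carrier G\<close>] by (rule DomainE)
    then show ?thesis using \<phi>[OF z] by simp
  qed
  have "\<phi> \<in> hom G circle_group"
  proof (rule homI)
    show "\<phi> a \<in> carrier circle_group" if "a \<in> carrier G" for a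
      using \<phi>'[OF that] \<Gamma>(1) by (auto simp: partial_character_def)
    show "\<phi> (a \<otimes> b) = \<phi> a \<otimes>\<^bsub>circle_group\<^esub> \<phi> b" if "a \<in> carrier G" "b \<in> carrier G" for a b
      by (simp add: \<phi>[OF mult[OF \<phi>'[OF that(1)] \<phi>'[OF that(2)]]])
  qed
  moreover have "\<phi> h = 1" if "h \<in> H" for h
    using that \<Gamma>0(2) \<Gamma>(2) by (intro \<phi>) blast
  moreover have "\<phi> x \<noteq> 1" using \<phi>[of x w] \<Gamma>0 \<Gamma>(2) by auto
  ultimately show ?thesis by blast
qed

section \<open>Group topologies from bases at the identity\<close>

text \<open>
  The classical axioms for a base of neighbourhoods of the identity. Such sets are usually not
  open, so a set is declared to be open if it contains a translate \<open>x U\<close> around each of its points \<open>x\<close>.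
\<close>

definition identity_base :: "'a set set \<Rightarrow> bool" where
  "identity_base \<B> \<longleftrightarrow> \<B> \<noteq> {} \<and>
     (\<forall>U\<in>\<B>. U \<subseteq> carrier G \<and> \<one> \<in> U \<and> (\<forall>x\<in>U. inv x \<in> U) \<and>
        (\<exists>V\<in>\<B>. \<forall>x\<in>V. \<forall>y\<in>V. x \<otimes> y \<in> U)) \<and>
     (\<forall>U\<in>\<B>. \<forall>V\<in>\<B>. \<exists>W\<in>\<B>. W \<subseteq> U \<inter> V)"

definition base_topology :: "'a set set \<Rightarrow> 'a topology" where
  "base_topology \<B> = topology (\<lambda>W. W \<subseteq> carrier G \<and> (\<forall>x\<in>W. \<exists>U\<in>\<B>. \<forall>u\<in>U. x \<otimes> u \<in> W))"

context
  fixes \<B> assumes base: "identity_base \<B>"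
begin

lemma identity_base_carrier: "U \<in> \<B> \<Longrightarrow> u \<in> U \<Longrightarrow> u \<in> carrier G"
  using base unfolding identity_base_def by blast

lemma identity_base_one: "U \<in> \<B> \<Longrightarrow> \<one> \<in> U"
  using base unfolding identity_base_def by blast

lemma identity_base_inv: "U \<in> \<B> \<Longrightarrow> x \<in> U \<Longrightarrow> inv x \<in> U"
  using base unfolding identity_base_def by blast

lemma identity_base_square:
  assumes "U \<in> \<B>"
  obtains V where "V \<in> \<B>" "\<forall>x\<in>V. \<forall>y\<in>V. x \<otimes> y \<in> U"
proof -
  have "\<exists>V\<in>\<B>. \<forall>x\<in>V. \<forall>y\<in>V. x \<otimes> y \<in> U"
    using base assms by (simp add: identity_base_def)
  then show thesis using that by (rule bexE)
qed

lemma identity_base_Int: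
  assumes "U \<in> \<B>" "V \<in> \<B>"
  obtains W where "W \<in> \<B>" "W \<subseteq> U \<inter> V"
proof -
  have "\<exists>W\<in>\<B>. W \<subseteq> U \<inter> V"
    using base assms by (simp add: identity_base_def)
  then show thesis using that by (rule bexE)
qed

lemma identity_base_nonempty: "\<B> \<noteq> {}"
  using base unfolding identity_base_def by blast

lemma openin_base_topology:
  "openin (base_topology \<B>) W \<longleftrightarrow> W \<subseteq> carrier G \<and> (\<forall>x\<in>W. \<exists>U\<in>\<B>. \<forall>u\<in>U. x \<otimes> u \<in> W)"
proof -
  have "istopology (\<lambda>W. W \<subseteq> carrier G \<and> (\<forall>x\<in>W. \<exists>U\<in>\<B>. \<forall>u\<in>U. x \<otimes> u \<in> W))"
    unfolding istopology_def
  proof (intro conjI allI impI ballI)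
    fix S T x
    assume S: "S \<subseteq> carrier G \<and> (\<forall>x\<in>S. \<exists>U\<in>\<B>. \<forall>u\<in>U. x \<otimes> u \<in> S)"
      and T: "T \<subseteq> carrier G \<and> (\<forall>x\<in>T. \<exists>U\<in>\<B>. \<forall>u\<in>U. x \<otimes> u \<in> T)" and x: "x \<in> S \<inter> T"
    obtain U where U: "U \<in> \<B>" "\<forall>u\<in>U. x \<otimes> u \<in> S" using S x by blast
    obtain V where V: "V \<in> \<B>" "\<forall>u\<in>V. x \<otimes> u \<in> T" using T x by blast
    obtain W where "W \<in> \<B>" "W \<subseteq> U \<inter> V"
      using U(1) V(1) by (rule identity_base_Int)
    with U V show "\<exists>U\<in>\<B>. \<forall>u\<in>U. x \<otimes> u \<in> S \<inter> T" by blast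
  next
    fix \<K> x
    assume \<K>: "\<forall>K\<in>\<K>. K \<subseteq> carrier G \<and> (\<forall>x\<in>K. \<exists>U\<in>\<B>. \<forall>u\<in>U. x \<otimes> u \<in> K)" and "x \<in> \<Union>\<K>"
    then obtain K where K: "K \<in> \<K>" "x \<in> K" by blast
    then obtain U where "U \<in> \<B>" "\<forall>u\<in>U. x \<otimes> u \<in> K" using \<K> by blast
    with K show "\<exists>U\<in>\<B>. \<forall>u\<in>U. x \<otimes> u \<in> \<Union>\<K>" by blast
  qed auto
  then show ?thesis by (simp add: base_topology_def)
qed

lemma topspace_base_topology: "topspace (base_topology \<B>) = carrier G"
proof -
  have "openin (base_topology \<B>) (carrier G)"
    using identity_base_nonempty identity_base_carrier unfolding openin_base_topology by blast
  moreover have "topspace (base_topology \<B>) \<subseteq> carrier G"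
    using openin_topspace[of "base_topology \<B>"] unfolding openin_base_topology by (rule conjunct1)
  ultimately show ?thesis by (simp add: openin_subset subset_antisym)
qed

text \<open>
  The interior of \<open>x U\<close> consists of the points around which \<open>x U\<close> contains a translate of a basic
  set. It is open because every basic set contains the square of another one.
\<close>

lemma base_neighbourhood:
  assumes U: "U \<in> \<B>" and x: "x \<in> carrier G"
  shows "\<exists>W. openin (base_topology \<B>) W \<and> x \<in> W \<and> (\<forall>w\<in>W. \<exists>u\<in>U. w = x \<otimes> u)"
proof -
  define W where "W = {y \<in> carrier G. \<exists>V\<in>\<B>. \<forall>v\<in>V. inv x \<otimes> (y \<otimes> v) \<in> U}"
  have "openin (base_topology \<B>) W"
    unfolding openin_base_topology
  proof (intro conjI ballI)
    fix y assume "y \<in> W"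
    then obtain V where y: "y \<in> carrier G" and V: "V \<in> \<B>" "\<forall>v\<in>V. inv x \<otimes> (y \<otimes> v) \<in> U"
      by (auto simp: W_def)
    obtain V' where V': "V' \<in> \<B>" "\<forall>a\<in>V'. \<forall>b\<in>V'. a \<otimes> b \<in> V"
      using V(1) by (rule identity_base_square)
    have "y \<otimes> v \<in> W" if "v \<in> V'" for v
    proof -
      have "inv x \<otimes> (y \<otimes> v \<otimes> b) \<in> U" if "b \<in> V'" for b
        using V(2) V' \<open>v \<in> V'\<close> that y identity_base_carrier[OF V'(1)] by (simp add: m_assoc)
      then show ?thesis using V'(1) y that identity_base_carrier[OF V'(1)]
        by (auto simp: W_def)
    qed
    then show "\<exists>U\<in>\<B>. \<forall>u\<in>U. y \<otimes> u \<in> W" using V'(1) by blast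
  qed (auto simp: W_def)
  moreover have "x \<in> W"
    using U x identity_base_carrier[OF U]
    by (auto simp: W_def m_assoc[symmetric] intro!: bexI[of _ U])
  moreover have "\<exists>u\<in>U. w = x \<otimes> u" if "w \<in> W" for w
  proof -
    obtain V where V: "V \<in> \<B>" "\<forall>v\<in>V. inv x \<otimes> (w \<otimes> v) \<in> U" and w: "w \<in> carrier G"
      using \<open>w \<in> W\<close> by (auto simp: W_def)
    have "\<one> \<in> V" using V(1) by (rule identity_base_one)
    then have "inv x \<otimes> w \<in> U" using V(2) w by fastforce
    then show ?thesis using x w by (intro bexI[of _ "inv x \<otimes> w"]) (simp_all add: m_assoc[symmetric])
  qed
  ultimately show ?thesis by blast
qed

lemma topological_abelian_group_base_topology: "topological_abelian_group G (base_topology \<B>)"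
  unfolding topological_abelian_group_def
proof (intro conjI)
  show "comm_group G" ..
  show "topspace (base_topology \<B>) = carrier G" by (rule topspace_base_topology)
  show "continuous_map (prod_topology (base_topology \<B>) (base_topology \<B>)) (base_topology \<B>) (\<lambda>(x, y). x \<otimes> y)"
    unfolding continuous_map topspace_prod_topology topspace_base_topology
  proof (intro conjI allI impI)
    fix W assume W: "openin (base_topology \<B>) W"
    show "openin (prod_topology (base_topology \<B>) (base_topology \<B>))
        {p \<in> carrier G \<times> carrier G. (case p of (x, y) \<Rightarrow> x \<otimes> y) \<in> W}"
      unfolding openin_prod_topology_alt
    proof (intro allI impI)
      fix x y assume "(x, y) \<in> {p \<in> carrier G \<times> carrier G. (case p of (x, y) \<Rightarrow> x \<otimes> y) \<in> W}"
      then have xy: "x \<in> carrier G" "y \<in> carrier G" "x \<otimes> y \<in> W" by auto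
      then obtain U where U: "U \<in> \<B>" "\<forall>u\<in>U. x \<otimes> y \<otimes> u \<in> W"
        using W unfolding openin_base_topology by blast
      obtain V where V: "V \<in> \<B>" "\<forall>a\<in>V. \<forall>b\<in>V. a \<otimes> b \<in> U"
        using U(1) by (rule identity_base_square)
      obtain W1 where W1: "openin (base_topology \<B>) W1" "x \<in> W1" "\<forall>w\<in>W1. \<exists>u\<in>V. w = x \<otimes> u"
        using base_neighbourhood[OF V(1) xy(1)] by blast
      obtain W2 where W2: "openin (base_topology \<B>) W2" "y \<in> W2" "\<forall>w\<in>W2. \<exists>u\<in>V. w = y \<otimes> u"
        using base_neighbourhood[OF V(1) xy(2)] by blast
      have "a \<otimes> b \<in> W" if "a \<in> W1" "b \<in> W2" for a b
      proof -
        obtain u v where uv: "u \<in> V" "v \<in> V" "a = x \<otimes> u" "b = y \<otimes> v"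
          using W1(3) W2(3) \<open>a \<in> W1\<close> \<open>b \<in> W2\<close> by blast
        then have "a \<otimes> b = x \<otimes> y \<otimes> (u \<otimes> v)"
          using xy identity_base_carrier[OF V(1)] by (simp add: m_ac)
        then show ?thesis using U V uv by simp
      qed
      moreover have "W1 \<subseteq> carrier G" "W2 \<subseteq> carrier G"
        using W1(1) W2(1) by (auto simp: openin_base_topology)
      ultimately have "W1 \<times> W2 \<subseteq> {p \<in> carrier G \<times> carrier G. (case p of (x, y) \<Rightarrow> x \<otimes> y) \<in> W}"
        by auto
      with W1 W2 show "\<exists>U V. openin (base_topology \<B>) U \<and> openin (base_topology \<B>) V \<and> x \<in> U \<and> y \<in> V \<and>
          U \<times> V \<subseteq> {p \<in> carrier G \<times> carrier G. (case p of (x, y) \<Rightarrow> x \<otimes> y) \<in> W}"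
        by blast
    qed
  qed auto
  show "continuous_map (base_topology \<B>) (base_topology \<B>) (\<lambda>x. inv x)"
    unfolding continuous_map topspace_base_topology
  proof (intro conjI allI impI)
    fix W assume W: "openin (base_topology \<B>) W"
    show "openin (base_topology \<B>) {x \<in> carrier G. inv x \<in> W}"
      unfolding openin_base_topology
    proof (intro conjI ballI)
      fix x assume "x \<in> {x \<in> carrier G. inv x \<in> W}"
      then have x: "x \<in> carrier G" "inv x \<in> W" by auto
      then obtain U where U: "U \<in> \<B>" "\<forall>u\<in>U. inv x \<otimes> u \<in> W"
        using W unfolding openin_base_topology by blast
      then have "\<forall>u\<in>U. x \<otimes> u \<in> {x \<in> carrier G. inv x \<in> W}"
        using x identity_base_carrier[OF U(1)] identity_base_inv[OF U(1)] by (auto simp: inv_mult)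
      then show "\<exists>U\<in>\<B>. \<forall>u\<in>U. x \<otimes> u \<in> {x \<in> carrier G. inv x \<in> W}" using U(1) by blast
    qed auto
  qed auto
qed

lemma Hausdorff_base_topology:
  assumes sep: "\<And>g. g \<in> carrier G \<Longrightarrow> g \<noteq> \<one> \<Longrightarrow> \<exists>U\<in>\<B>. g \<notin> U"
  shows "Hausdorff_space (base_topology \<B>)"
  unfolding Hausdorff_space_def topspace_base_topology
proof (intro allI impI, elim conjE)
  fix x y assume xy: "x \<in> carrier G" "y \<in> carrier G" "x \<noteq> y"
  have "inv x \<otimes> y \<noteq> \<one>"
  proof
    assume "inv x \<otimes> y = \<one>"
    then have "x \<otimes> (inv x \<otimes> y) = x" using xy by simp
    then show False using xy by (simp add: m_assoc[symmetric])
  qed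
  with sep[of "inv x \<otimes> y"] xy obtain U where U: "U \<in> \<B>" "inv x \<otimes> y \<notin> U"
    by auto
  obtain V where V: "V \<in> \<B>" "\<forall>a\<in>V. \<forall>b\<in>V. a \<otimes> b \<in> U"
    using U(1) by (rule identity_base_square)
  note inv = identity_base_inv[OF V(1)]
  obtain W1 where W1: "openin (base_topology \<B>) W1" "x \<in> W1" "\<forall>w\<in>W1. \<exists>u\<in>V. w = x \<otimes> u"
    using base_neighbourhood[OF V(1) xy(1)] by blast
  obtain W2 where W2: "openin (base_topology \<B>) W2" "y \<in> W2" "\<forall>w\<in>W2. \<exists>u\<in>V. w = y \<otimes> u"
    using base_neighbourhood[OF V(1) xy(2)] by blast
  have False if "w \<in> W1" "w \<in> W2" for w
  proof -
    obtain u v where uv: "u \<in> V" "v \<in> V" "w = x \<otimes> u" "w = y \<otimes> v"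
      using W1(3) W2(3) \<open>w \<in> W1\<close> \<open>w \<in> W2\<close> by blast
    have c: "u \<in> carrier G" "v \<in> carrier G" using uv identity_base_carrier[OF V(1)] by auto
    have "inv x \<otimes> y = inv x \<otimes> (y \<otimes> v) \<otimes> inv v"
      using xy c by (simp add: m_assoc)
    also have "\<dots> = inv x \<otimes> (x \<otimes> u) \<otimes> inv v" using uv by simp
    also have "\<dots> = u \<otimes> inv v" using xy c by (simp add: m_assoc[symmetric])
    finally show False using U V inv uv by auto
  qed
  then show "\<exists>U V. openin (base_topology \<B>) U \<and> openin (base_topology \<B>) V \<and> x \<in> U \<and> y \<in> V \<and> disjnt U V"
    using W1 W2 by (meson disjnt_iff)
qed

lemma base_topology_not_discrete:
  assumes "\<And>U. U \<in> \<B> \<Longrightarrow> U \<noteq> {\<one>}"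
  shows "base_topology \<B> \<noteq> discrete_topology (carrier G)"
proof
  assume "base_topology \<B> = discrete_topology (carrier G)"
  then have "openin (base_topology \<B>) {\<one>}" by simp
  then obtain U where U: "U \<in> \<B>" "\<forall>u\<in>U. \<one> \<otimes> u \<in> {\<one>}"
    by (auto simp: openin_base_topology)
  then have "U \<subseteq> {\<one>}" using identity_base_carrier[OF U(1)] by auto
  moreover have "\<one> \<in> U" using U(1) by (rule identity_base_one)
  ultimately show False using assms[OF U(1)] by blast
qed

end

section \<open>Continuous characters\<close>

text \<open>
  The preimage of any set whatsoever is open: it is a union of translates of \<open>W\<close>.
\<close>

lemma continuous_hom_if_trivial_nearby:
  assumes T: "topological_abelian_group G T" and \<phi>: "\<phi> \<in> hom G circle_group"
    and W: "openin T W" "\<one> \<in> W" "\<And>w. w \<in> W \<Longrightarrow> \<phi> w = 1"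
  shows "\<phi> \<in> continuous_characters G T"
proof -
  have ts: "topspace T = carrier G" and mult: "continuous_map (prod_topology T T) T (\<lambda>(x, y). x \<otimes> y)"
    using T by (auto simp: topological_abelian_group_def)
  have \<phi>_closed: "norm (\<phi> x) = 1" if "x \<in> carrier G" for x
    using \<phi> that by (auto simp: hom_def Pi_iff)
  have "openin T {x \<in> topspace T. \<phi> x \<in> S}" for S
  proof (subst openin_subopen, intro ballI)
    fix x assume "x \<in> {x \<in> topspace T. \<phi> x \<in> S}"
    then have x: "x \<in> carrier G" "\<phi> x \<in> S" by (auto simp: ts)
    have "continuous_map T T ((\<lambda>(a, b). a \<otimes> b) \<circ> (\<lambda>y. (inv x, y)))"
      using x by (intro continuous_map_compose[OF _ mult])
        (simp add: continuous_map_paired continuous_map_const ts)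
    from openin_continuous_map_preimage[OF this W(1)]
    have "openin T {y \<in> carrier G. inv x \<otimes> y \<in> W}" by (simp add: ts)
    moreover have "\<phi> y \<in> S" if "y \<in> carrier G" "inv x \<otimes> y \<in> W" for y
    proof -
      have "y = x \<otimes> (inv x \<otimes> y)" using x that by (simp add: m_assoc[symmetric])
      then have "\<phi> y = \<phi> x * \<phi> (inv x \<otimes> y)"
        using hom_mult[OF \<phi> x(1), of "inv x \<otimes> y"] x that by simp
      then show ?thesis using x W(3) that by simp
    qed
    ultimately show "\<exists>V. openin T V \<and> x \<in> V \<and> V \<subseteq> {x \<in> topspace T. \<phi> x \<in> S}"
      using x W(2) by (intro exI[of _ "{y \<in> carrier G. inv x \<otimes> y \<in> W}"]) (auto simp: ts)
  qed
  then have "continuous_map T (top_of_set (sphere 0 1)) \<phi>"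
    using \<phi>_closed by (simp add: continuous_map ts image_subset_iff)
  then show ?thesis using \<phi> by (simp add: continuous_characters_def)
qed

text \<open>
  In a group of exponent dividing \<open>M\<close> a character takes values in the finite set of \<open>M\<close>-th roots of
  unity, where \<open>1\<close> is isolated.
\<close>

lemma open_kernel_continuous_character:
  assumes exp: "M > 0" "\<And>x. x \<in> carrier G \<Longrightarrow> x [^] (M::nat) = \<one>"
    and T: "topological_abelian_group G T" and \<phi>: "\<phi> \<in> continuous_characters G T"
  shows "openin T {x \<in> carrier G. \<phi> x = 1}"
proof -
  define R where "R = {z::complex. z ^ M = 1} - {1}"
  have "finite R" unfolding R_def using exp(1) by (simp add: finite_roots_unity)
  then have "openin (top_of_set (sphere 0 1)) (sphere 0 1 \<inter> - R)"
    by (simp add: finite_imp_closed openin_open_Int open_Compl)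
  moreover have hom: "\<phi> \<in> hom G circle_group" and cont: "continuous_map T (top_of_set (sphere 0 1)) \<phi>"
    using \<phi> by (auto simp: continuous_characters_def)
  ultimately have "openin T {x \<in> topspace T. \<phi> x \<in> sphere 0 1 \<inter> - R}"
    by (intro openin_continuous_map_preimage[OF cont])
  moreover have "\<phi> x \<in> sphere 0 1 \<inter> - R \<longleftrightarrow> \<phi> x = 1" if "x \<in> carrier G" for x
  proof -
    interpret \<phi>: group_hom G circle_group \<phi>
      using hom comm_group_circle_group by (simp add: group_hom_def group_hom_axioms_def comm_group_def is_group)
    have "\<phi> x ^ M = 1"
      using \<phi>.hom_nat_pow[OF that, of M] exp that by (simp add: circle_group_pow)
    moreover have "norm (\<phi> x) = 1" using \<phi>.hom_closed[OF that] by simp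
    ultimately show ?thesis by (auto simp: R_def)
  qed
  ultimately show ?thesis
    using T by (simp add: topological_abelian_group_def cong: conj_cong)
qed

section \<open>The finest group topology in which a sequence tends to the identity\<close>

definition signed_tail :: "(nat \<Rightarrow> 'a) \<Rightarrow> nat \<Rightarrow> 'a set" where
  "signed_tail u m = insert \<one> (u ` {m..} \<union> (\<lambda>n. inv u n) ` {m..})"

primrec tail_products :: "(nat \<Rightarrow> 'a) \<Rightarrow> (nat \<Rightarrow> nat) \<Rightarrow> nat \<Rightarrow> 'a set" where
  "tail_products u k 0 = {\<one>}"
| "tail_products u k (Suc n) = (\<Union>x\<in>tail_products u k n. (\<lambda>a. x \<otimes> a) ` signed_tail u (k n))"

text \<open>
  A neighbourhood of the identity in the finest group topology with \<open>u \<longlonglongrightarrow> \<one>\<close> is given by a function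
  \<open>k\<close>: it consists of all finite products \<open>a\<^sub>0 a\<^sub>1 \<dots> a\<^sub>n\<close> in which \<open>a\<^sub>i\<close> is \<open>\<one>\<close> or one of the
  elements \<open>u j\<close>, \<open>inv (u j)\<close> with \<open>j \<ge> k i\<close>. Unlike the subgroups generated by tails of \<open>u\<close>, these sets limit how
  many terms with small index may occur, which is why they can shrink to \<open>\<one>\<close> even when every tail
  generates a large subgroup.
\<close>

definition sequence_neighbourhood :: "(nat \<Rightarrow> 'a) \<Rightarrow> (nat \<Rightarrow> nat) \<Rightarrow> 'a set" where
  "sequence_neighbourhood u k = (\<Union>n. tail_products u k n)"

definition sequence_topology :: "(nat \<Rightarrow> 'a) \<Rightarrow> 'a topology" where
  "sequence_topology u = base_topology (range (sequence_neighbourhood u))"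

context
  fixes u :: "nat \<Rightarrow> 'a"
  assumes u: "\<And>n. u n \<in> carrier G"
begin

lemma signed_tail_carrier: "a \<in> signed_tail u m \<Longrightarrow> a \<in> carrier G"
  using u by (auto simp: signed_tail_def)

lemma signed_tail_one [simp]: "\<one> \<in> signed_tail u m"
  by (simp add: signed_tail_def)

lemma signed_tail_inv: "a \<in> signed_tail u m \<Longrightarrow> inv a \<in> signed_tail u m"
  using u by (auto simp: signed_tail_def)

lemma signed_tail_antimono: "m \<le> m' \<Longrightarrow> signed_tail u m' \<subseteq> signed_tail u m"
  by (auto simp: signed_tail_def)

lemma tail_products_carrier: "x \<in> tail_products u k n \<Longrightarrow> x \<in> carrier G"
  by (induction n arbitrary: x) (auto dest: signed_tail_carrier)

lemma tail_products_SucI: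
  "x \<in> tail_products u k n \<Longrightarrow> a \<in> signed_tail u (k n) \<Longrightarrow> x \<otimes> a \<in> tail_products u k (Suc n)"
  by auto

lemma tail_products_one: "\<one> \<in> tail_products u k n"
  by (induction n) (auto intro!: bexI[of _ \<one>] image_eqI[of _ _ \<one>])

lemma tail_products_antimono:
  assumes "\<And>i. k i \<le> k' i"
  shows "x \<in> tail_products u k' n \<Longrightarrow> x \<in> tail_products u k n"
proof (induction n arbitrary: x)
  case (Suc n)
  then obtain y a where "y \<in> tail_products u k' n" "a \<in> signed_tail u (k' n)" "x = y \<otimes> a" by auto
  then show ?case
    using Suc.IH signed_tail_antimono[OF assms, of n] by (auto simp del: tail_products.simps intro!: tail_products_SucI)
qed simp

lemma tail_products_inv: "x \<in> tail_products u k n \<Longrightarrow> inv x \<in> tail_products u k n"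
proof (induction n arbitrary: x)
  case (Suc n)
  then obtain y a where *: "y \<in> tail_products u k n" "a \<in> signed_tail u (k n)" "x = y \<otimes> a" by auto
  then have "inv y \<otimes> inv a \<in> tail_products u k (Suc n)"
    using Suc.IH signed_tail_inv by (intro tail_products_SucI)
  moreover have "inv x = inv y \<otimes> inv a"
    using * by (simp add: inv_mult tail_products_carrier signed_tail_carrier)
  ultimately show ?case by (simp only:)
qed simp

text \<open>
  The product of two words is read as a single word by alternating their letters.
\<close>

lemma tail_products_interleave:
  assumes "\<And>i. k (2 * i) \<le> l i" "\<And>i. k (Suc (2 * i)) \<le> l i"
  shows "x \<in> tail_products u l n \<Longrightarrow> y \<in> tail_products u l n \<Longrightarrow> x \<otimes> y \<in> tail_products u k (2 * n)"
proof (induction n arbitrary: x y)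
  case (Suc n)
  then obtain x' a y' b where *: "x' \<in> tail_products u l n" "a \<in> signed_tail u (l n)" "x = x' \<otimes> a"
    "y' \<in> tail_products u l n" "b \<in> signed_tail u (l n)" "y = y' \<otimes> b" by auto
  have "x' \<otimes> y' \<otimes> a \<otimes> b \<in> tail_products u k (Suc (Suc (2 * n)))"
    using * Suc.IH signed_tail_antimono[OF assms(1)[of n]] signed_tail_antimono[OF assms(2)[of n]]
    by (intro tail_products_SucI) auto
  moreover have "x' \<otimes> y' \<otimes> a \<otimes> b = x \<otimes> y"
    using *(1,4) tail_products_carrier signed_tail_carrier[OF *(2)] signed_tail_carrier[OF *(5)] 
    by (simp add: *(3,6) m_ac)
  moreover have "2 * Suc n = Suc (Suc (2 * n))" by simp
  ultimately show ?case by (simp only:)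
qed simp

lemma tail_products_add:
  "x \<in> tail_products u k (n + m) \<longleftrightarrow>
     (\<exists>y\<in>tail_products u k n. \<exists>z\<in>tail_products u (\<lambda>i. k (n + i)) m. x = y \<otimes> z)"
proof (induction m arbitrary: x)
  case 0
  show ?case using tail_products_carrier by auto
next
  case (Suc m)
  show ?case
  proof
    assume "x \<in> tail_products u k (n + Suc m)"
    then obtain w a where "w \<in> tail_products u k (n + m)" and a: "a \<in> signed_tail u (k (n + m))" "x = w \<otimes> a"
      by auto
    with Suc.IH obtain y z where yz: "y \<in> tail_products u k n" "z \<in> tail_products u (\<lambda>i. k (n + i)) m"
      "w = y \<otimes> z" by blast
    then have "x = y \<otimes> (z \<otimes> a)"
      using a tail_products_carrier[OF yz(1)] tail_products_carrier[OF yz(2)] signed_tail_carrier[OF a(1)] by (simp add: m_assoc)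
    moreover have "z \<otimes> a \<in> tail_products u (\<lambda>i. k (n + i)) (Suc m)"
      using yz a by (intro tail_products_SucI)
    ultimately show "\<exists>y\<in>tail_products u k n. \<exists>z\<in>tail_products u (\<lambda>i. k (n + i)) (Suc m). x = y \<otimes> z"
      using yz(1) by blast
  next
    assume "\<exists>y\<in>tail_products u k n. \<exists>z\<in>tail_products u (\<lambda>i. k (n + i)) (Suc m). x = y \<otimes> z"
    then obtain y z a where *: "y \<in> tail_products u k n" "z \<in> tail_products u (\<lambda>i. k (n + i)) m"
      "a \<in> signed_tail u (k (n + m))" "x = y \<otimes> (z \<otimes> a)" by auto
    then have "x = y \<otimes> z \<otimes> a"
      using tail_products_carrier[OF *(1)] tail_products_carrier[OF *(2)] signed_tail_carrier[OF *(3)] by (simp add: m_assoc)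
    moreover have "y \<otimes> z \<in> tail_products u k (n + m)" using Suc.IH * by blast
    ultimately show "x \<in> tail_products u k (n + Suc m)"
      using *(3) by auto
  qed
qed

lemma sequence_neighbourhood_antimono:
  assumes "\<And>i. k i \<le> k' i"
  shows "sequence_neighbourhood u k' \<subseteq> sequence_neighbourhood u k"
  unfolding sequence_neighbourhood_def by (intro UN_mono subset_refl subsetI tail_products_antimono[OF assms])

lemma tail_products_mono:
  assumes "n \<le> n'" "x \<in> tail_products u k n"
  shows "x \<in> tail_products u k n'"
proof -
  have "x \<in> tail_products u k (n + (n' - n))"
    unfolding tail_products_add
    using assms(2) tail_products_one tail_products_carrier[OF assms(2)]
    by (intro bexI[of _ x] bexI[of _ \<one>]) auto
  then show ?thesis using assms(1) by simp
qed

lemma sequence_neighbourhood_square: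
  "\<exists>l. \<forall>x\<in>sequence_neighbourhood u l. \<forall>y\<in>sequence_neighbourhood u l. x \<otimes> y \<in> sequence_neighbourhood u k"
proof (rule exI[of _ "\<lambda>i. max (k (2 * i)) (k (Suc (2 * i)))"], intro ballI)
  let ?l = "\<lambda>i. max (k (2 * i)) (k (Suc (2 * i)))"
  fix x y assume "x \<in> sequence_neighbourhood u ?l" "y \<in> sequence_neighbourhood u ?l"
  then obtain n m where "x \<in> tail_products u ?l n" "y \<in> tail_products u ?l m"
    by (auto simp: sequence_neighbourhood_def)
  then have "x \<in> tail_products u ?l (max n m)" "y \<in> tail_products u ?l (max n m)"
    by (auto intro: tail_products_mono[rotated])
  then have "x \<otimes> y \<in> tail_products u k (2 * max n m)"
    by (rule tail_products_interleave[rotated 2]) auto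
  then show "x \<otimes> y \<in> sequence_neighbourhood u k" by (auto simp: sequence_neighbourhood_def)
qed

lemma signed_tail_in_neighbourhood: "signed_tail u (k 0) \<subseteq> sequence_neighbourhood u k"
proof
  fix a assume "a \<in> signed_tail u (k 0)"
  then have "a \<in> tail_products u k (Suc 0)" using signed_tail_carrier by force
  then show "a \<in> sequence_neighbourhood u k" unfolding sequence_neighbourhood_def by blast
qed

lemma identity_base_sequence_neighbourhoods: "identity_base (range (sequence_neighbourhood u))"
  unfolding identity_base_def
proof (intro conjI ballI; (elim rangeE)?)
  fix U k assume U: "U = sequence_neighbourhood u k"
  show "U \<subseteq> carrier G" "\<one> \<in> U"
    using tail_products_carrier tail_products_one by (auto simp: U sequence_neighbourhood_def)
  show "\<exists>V\<in>range (sequence_neighbourhood u). \<forall>x\<in>V. \<forall>y\<in>V. x \<otimes> y \<in> U"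
    using sequence_neighbourhood_square[of k] unfolding U by blast
  show "inv x \<in> U" if "x \<in> U" for x
    using that tail_products_inv by (auto simp: U sequence_neighbourhood_def)
next
  fix U V k l assume "U = sequence_neighbourhood u k" "V = sequence_neighbourhood u l"
  then show "\<exists>W\<in>range (sequence_neighbourhood u). W \<subseteq> U \<inter> V"
    using sequence_neighbourhood_antimono[of k "\<lambda>i. max (k i) (l i)"]
      sequence_neighbourhood_antimono[of l "\<lambda>i. max (k i) (l i)"] by auto
qed auto

text \<open>
  For a constant index function nothing bounds the number of letters.
\<close>

lemma sequence_neighbourhood_const: "sequence_neighbourhood u (\<lambda>_. m) = generate G (u ` {m..})"
proof
  have "tail_products u (\<lambda>_. m) n \<subseteq> generate G (u ` {m..})" for n
  proof (induction n)
    case (Suc n)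
    have "signed_tail u m \<subseteq> generate G (u ` {m..})"
      by (auto simp: signed_tail_def intro: generate.intros)
    with Suc show ?case by (auto intro!: generate.eng)
  qed (auto intro: generate.one)
  then show "sequence_neighbourhood u (\<lambda>_. m) \<subseteq> generate G (u ` {m..})"
    by (auto simp: sequence_neighbourhood_def)
  show "generate G (u ` {m..}) \<subseteq> sequence_neighbourhood u (\<lambda>_. m)"
  proof
    fix x assume "x \<in> generate G (u ` {m..})"
    then show "x \<in> sequence_neighbourhood u (\<lambda>_. m)"
    proof induction
      case one
      show ?case using tail_products_one by (auto simp: sequence_neighbourhood_def)
    next
      case (incl h)
      then show ?case using signed_tail_in_neighbourhood[of "\<lambda>_. m"] by (auto simp: signed_tail_def)
    next
      case (inv h)
      then show ?case using signed_tail_in_neighbourhood[of "\<lambda>_. m"] by (auto simp: signed_tail_def)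
    next
      case (eng x y)
      then obtain n l where "x \<in> tail_products u (\<lambda>_. m) n" "y \<in> tail_products u (\<lambda>_. m) l"
        by (auto simp: sequence_neighbourhood_def)
      then have "x \<otimes> y \<in> tail_products u (\<lambda>_. m) (n + l)" by (auto simp: tail_products_add)
      then show ?case unfolding sequence_neighbourhood_def by blast
    qed
  qed
qed

lemma countable_generate_range: "countable (generate G (range u))"
proof -
  have "countable (tail_products u k n)" for k n
    by (induction n) (auto simp: signed_tail_def)
  then have "countable (sequence_neighbourhood u (\<lambda>_. 0))"
    by (simp add: sequence_neighbourhood_def)
  then show ?thesis by (simp add: sequence_neighbourhood_const atLeast_0)
qed

lemmas topological_abelian_group_sequence_topology =
  topological_abelian_group_base_topology[OF identity_base_sequence_neighbourhoods, folded sequence_topology_def]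

lemma Hausdorff_sequence_topology:
  assumes "\<And>g. g \<in> carrier G \<Longrightarrow> g \<noteq> \<one> \<Longrightarrow> \<exists>k. g \<notin> sequence_neighbourhood u k"
  shows "Hausdorff_space (sequence_topology u)"
  unfolding sequence_topology_def
  using assms by (intro Hausdorff_base_topology identity_base_sequence_neighbourhoods) auto

lemma sequence_topology_not_discrete:
  assumes "\<And>m. \<exists>n\<ge>m. u n \<noteq> \<one>"
  shows "sequence_topology u \<noteq> discrete_topology (carrier G)"
  unfolding sequence_topology_def
proof (rule base_topology_not_discrete[OF identity_base_sequence_neighbourhoods])
  fix U assume "U \<in> range (sequence_neighbourhood u)"
  then obtain k where U: "U = sequence_neighbourhood u k" by blast
  obtain n where "n \<ge> k 0" "u n \<noteq> \<one>" using assms by blast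
  then have "u n \<in> U"
    using signed_tail_in_neighbourhood[of k] by (auto simp: U signed_tail_def)
  with \<open>u n \<noteq> \<one>\<close> show "U \<noteq> {\<one>}" by auto
qed

lemma sequence_neighbourhood_open:
  "x \<in> carrier G \<Longrightarrow> \<exists>W. openin (sequence_topology u) W \<and> x \<in> W \<and> (\<forall>w\<in>W. inv x \<otimes> w \<in> sequence_neighbourhood u k)"
proof -
  assume x: "x \<in> carrier G"
  from base_neighbourhood[OF identity_base_sequence_neighbourhoods rangeI x, of k]
  obtain W where "openin (sequence_topology u) W" "x \<in> W" "\<forall>w\<in>W. \<exists>v\<in>sequence_neighbourhood u k. w = x \<otimes> v"
    unfolding sequence_topology_def by blast
  moreover have "inv x \<otimes> (x \<otimes> v) = v" if "v \<in> sequence_neighbourhood u k" for v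
    using that x tail_products_carrier by (auto simp: sequence_neighbourhood_def m_assoc[symmetric])
  ultimately show ?thesis by (intro exI[of _ W]) auto
qed

text \<open>
  Suppose a Cauchy filter \<open>F\<close> does not converge. Then it has no cluster point, so it eventually
  avoids a neighbourhood of each point. The set \<open>K\<^sub>n\<close> of words of length \<open>n\<close> behaves like a compact
  set: all but finitely many choices of its last letter are absorbed by a neighbourhood, so by induction
  on \<open>n\<close> the filter eventually avoids \<open>g K\<^sub>n U\<^sub>n\<close> for some neighbourhood \<open>U\<^sub>n\<close>. A diagonal choice
  gives one neighbourhood \<open>W\<close> with \<open>W \<subseteq> K\<^sub>n U\<^sub>2\<^sub>n\<close> for all \<open>n\<close>, where \<open>U\<^sub>2\<^sub>n\<close> is the one belonging to
  \<open>K\<^sub>2\<^sub>n\<close>. By the Cauchy property \<open>F\<close> eventually lies in \<open>g y W\<close> for some \<open>y\<close>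
  in the subgroup generated by \<open>u\<close>. If \<open>y \<in> K\<^sub>n\<close>, then \<open>g y W \<subseteq> g K\<^sub>2\<^sub>n U\<^sub>2\<^sub>n\<close>, a contradiction.
\<close>

theorem complete_sequence_topology: "complete_group_topology G (sequence_topology u)"
  unfolding complete_group_topology_def
proof (intro allI impI, rule ccontr)
  let ?T = "sequence_topology u" and ?N = "sequence_neighbourhood u"
  fix F assume F: "group_cauchy_filter G ?T F" and no_limit: "\<nexists>l. limitin ?T (\<lambda>x. x) l F"
  have F_bot: "F \<noteq> bot" and F_carrier: "\<forall>\<^sub>F x in F. x \<in> carrier G"
    using F by (auto simp: group_cauchy_filter_def le_principal)
  have N_carrier: "x \<in> carrier G" if "x \<in> ?N k" for x k
    using that tail_products_carrier by (auto simp: sequence_neighbourhood_def)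
  have cauchy: "\<exists>P. eventually P F \<and> (\<forall>x y. P x \<longrightarrow> P y \<longrightarrow> x \<in> carrier G \<and> x \<otimes> inv y \<in> ?N k)" for k
  proof -
    obtain W where W: "openin ?T W" "\<one> \<in> W" "\<forall>w\<in>W. inv \<one> \<otimes> w \<in> ?N k"
      using sequence_neighbourhood_open[OF one_closed] by blast
    then have "\<forall>\<^sub>F (x, y) in F \<times>\<^sub>F F. x \<otimes> inv y \<in> W"
      using F by (simp add: group_cauchy_filter_def)
    then obtain P where P: "eventually P F" "\<And>x y. P x \<Longrightarrow> P y \<Longrightarrow> x \<otimes> inv y \<in> W"
      unfolding eventually_prod_same by auto
    have "eventually (\<lambda>x. P x \<and> x \<in> carrier G) F" using P(1) F_carrier by (rule eventually_conj)
    moreover have "x \<otimes> inv y \<in> ?N k" if "P x" "P y" "x \<in> carrier G" "y \<in> carrier G" for x y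
      using W(3) P(2)[OF that(1,2)] that by force
    ultimately show ?thesis by (intro exI[of _ "\<lambda>x. P x \<and> x \<in> carrier G"]) auto
  qed
  \<comment> \<open>A Cauchy filter converges to each of its cluster points.\<close>
  have avoid0: "\<exists>k. \<forall>\<^sub>F x in F. inv g \<otimes> x \<notin> ?N k" if g: "g \<in> carrier G" for g
  proof -
    have "\<not> limitin ?T (\<lambda>x. x) g F" using no_limit by blast
    then obtain W where W: "openin ?T W" "g \<in> W" "\<not> (\<forall>\<^sub>F x in F. x \<in> W)"
      using g topspace_base_topology[OF identity_base_sequence_neighbourhoods]
      by (auto simp: limitin_def sequence_topology_def)
    then obtain k where k: "\<forall>v\<in>?N k. g \<otimes> v \<in> W"
      unfolding sequence_topology_def openin_base_topology[OF identity_base_sequence_neighbourhoods] by blast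
    obtain l where l: "\<forall>x\<in>?N l. \<forall>y\<in>?N l. x \<otimes> y \<in> ?N k" using sequence_neighbourhood_square by blast
    obtain P where P: "eventually P F" "\<And>x y. P x \<Longrightarrow> P y \<Longrightarrow> x \<in> carrier G \<and> x \<otimes> inv y \<in> ?N l"
      using cauchy[of l] by blast
    have "inv g \<otimes> y \<notin> ?N l" if "P y" for y
    proof
      assume y: "inv g \<otimes> y \<in> ?N l"
      have "x \<in> W" if "P x" for x
      proof -
        have c: "x \<in> carrier G" "y \<in> carrier G" "x \<otimes> inv y \<in> ?N l" using P(2) that \<open>P y\<close> by auto
        have "g \<otimes> ((x \<otimes> inv y) \<otimes> (inv g \<otimes> y)) \<in> W" using k l c y by blast
        moreover have "g \<otimes> ((x \<otimes> inv y) \<otimes> (inv g \<otimes> y)) = (g \<otimes> inv g) \<otimes> ((inv y \<otimes> y) \<otimes> x)"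
          using c g by (simp only: m_ac inv_closed m_closed)
        ultimately show ?thesis using c g by simp
      qed
      then have "\<forall>\<^sub>F x in F. x \<in> W" by (rule eventually_mono[OF P(1)])
      with W(3) show False by (rule notE)
    qed
    then have "\<forall>\<^sub>F x in F. inv g \<otimes> x \<notin> ?N l" by (rule eventually_mono[OF P(1)])
    then show ?thesis by (rule exI[of _ l])
  qed
  let ?K = "tail_products u (\<lambda>_. 0)"
  have avoid: "\<exists>k. \<forall>\<^sub>F x in F. \<forall>a\<in>?K n. inv (g \<otimes> a) \<otimes> x \<notin> ?N k" if "g \<in> carrier G" for g n
    using that
  proof (induction n arbitrary: g)
    case 0
    then show ?case using avoid0[of g] by simp
  next
    case (Suc n)
    obtain k where k: "\<forall>\<^sub>F x in F. \<forall>a\<in>?K n. inv (g \<otimes> a) \<otimes> x \<notin> ?N k"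
      using Suc.IH[OF Suc.prems] by blast
    obtain l where l: "\<forall>x\<in>?N l. \<forall>y\<in>?N l. x \<otimes> y \<in> ?N k" using sequence_neighbourhood_square by blast
    \<comment> \<open>The letters that are not already absorbed by the neighbourhood given by l.\<close>
    define B where "B = u ` {..<l 0} \<union> (\<lambda>i. inv u i) ` {..<l 0}"
    have B: "finite B" "B \<subseteq> carrier G" using u by (auto simp: B_def)
    have "\<forall>b\<in>B. \<exists>k. \<forall>\<^sub>F x in F. \<forall>a\<in>?K n. inv (g \<otimes> b \<otimes> a) \<otimes> x \<notin> ?N k"
    proof
      fix b assume "b \<in> B"
      then show "\<exists>k. \<forall>\<^sub>F x in F. \<forall>a\<in>?K n. inv (g \<otimes> b \<otimes> a) \<otimes> x \<notin> ?N k"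
        using Suc.prems B(2) by (intro Suc.IH) auto
    qed
    then obtain \<kappa> where \<kappa>: "\<forall>b\<in>B. \<forall>\<^sub>F x in F. \<forall>a\<in>?K n. inv (g \<otimes> b \<otimes> a) \<otimes> x \<notin> ?N (\<kappa> b)"
      by (elim bchoice[THEN exE])
    define k' where "k' i = l i + (\<Sum>b\<in>B. \<kappa> b i)" for i
    have "\<kappa> b i \<le> k' i" if "b \<in> B" for b i
      using member_le_sum[OF that, of "\<lambda>b. \<kappa> b i"] B(1) by (simp add: k'_def)
    then have sub: "?N k' \<subseteq> ?N l" "\<And>b. b \<in> B \<Longrightarrow> ?N k' \<subseteq> ?N (\<kappa> b)"
      by (auto intro!: sequence_neighbourhood_antimono simp: k'_def)
    have "\<forall>\<^sub>F x in F. \<forall>b\<in>B. \<forall>a\<in>?K n. inv (g \<otimes> b \<otimes> a) \<otimes> x \<notin> ?N (\<kappa> b)"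
      using \<kappa> B(1) by (simp add: eventually_ball_finite)
    then have "\<forall>\<^sub>F x in F. \<forall>a\<in>?K (Suc n). inv (g \<otimes> a) \<otimes> x \<notin> ?N k'"
      using k F_carrier
    proof eventually_elim
      case (elim x)
      show ?case
      proof (intro ballI notI)
        fix c assume c: "c \<in> ?K (Suc n)" and bad: "inv (g \<otimes> c) \<otimes> x \<in> ?N k'"
        then obtain a b where ab: "a \<in> ?K n" "b \<in> signed_tail u 0" "c = a \<otimes> b" by auto
        have carr: "a \<in> carrier G" "b \<in> carrier G"
          using ab tail_products_carrier signed_tail_carrier by auto
        show False
        proof (cases "b \<in> signed_tail u (l 0)")
          case True
          have "b \<otimes> (inv (g \<otimes> c) \<otimes> x) = (b \<otimes> inv b) \<otimes> (inv (g \<otimes> a) \<otimes> x)"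
            using Suc.prems carr elim(3) by (simp only: ab(3) inv_mult m_ac m_closed inv_closed)
          then have "b \<otimes> (inv (g \<otimes> c) \<otimes> x) = inv (g \<otimes> a) \<otimes> x"
            using Suc.prems carr elim by simp
          moreover have "b \<otimes> (inv (g \<otimes> c) \<otimes> x) \<in> ?N k"
            using l bad sub(1) signed_tail_in_neighbourhood[of l] True by blast
          ultimately show False using elim(2) ab(1) by simp
        next
          case False
          then have "b \<in> B" using ab(2) by (fastforce simp: B_def signed_tail_def)
          moreover have "g \<otimes> c = g \<otimes> b \<otimes> a" using ab Suc.prems carr by (simp add: m_ac)
          ultimately show False using elim(1) ab(1) bad sub(2) by auto
        qed
      qed
    qed
    then show ?case by (rule exI[of _ k'])
  qed
  obtain P0 where P0: "eventually P0 F" "\<And>x y. P0 x \<Longrightarrow> P0 y \<Longrightarrow> x \<in> carrier G \<and> x \<otimes> inv y \<in> ?N (\<lambda>_. 0)"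
    using cauchy[of "\<lambda>_. 0"] by blast
  obtain g where "P0 g" using eventually_happens'[OF F_bot P0(1)] by blast
  then have g: "g \<in> carrier G" using P0(2) by blast
  have "\<forall>n. \<exists>k. \<forall>\<^sub>F x in F. \<forall>a\<in>?K (n + n). inv (g \<otimes> a) \<otimes> x \<notin> ?N k"
    by (intro allI avoid g)
  then obtain w where "\<forall>n. \<forall>\<^sub>F x in F. \<forall>a\<in>?K (n + n). inv (g \<otimes> a) \<otimes> x \<notin> ?N (w n)"
    by (elim choice[THEN exE])
  then have w: "\<And>n. \<forall>\<^sub>F x in F. \<forall>a\<in>?K (n + n). inv (g \<otimes> a) \<otimes> x \<notin> ?N (w n)" by (rule spec)
  \<comment> \<open>The diagonal choice: after its first n letters, a word in the neighbourhood given by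
    \<open>\<kappa>\<close> is a word in the neighbourhood given by \<open>w n\<close>.\<close>
  define \<kappa> where "\<kappa> i = (\<Sum>n\<le>i. w n (i - n))" for i
  have \<kappa>: "w n i \<le> \<kappa> (n + i)" for n i
    using member_le_sum[of n "{..n + i}" "\<lambda>m. w m (n + i - m)"] by (simp add: \<kappa>_def)
  obtain P where P: "eventually P F" "\<And>x y. P x \<Longrightarrow> P y \<Longrightarrow> x \<in> carrier G \<and> x \<otimes> inv y \<in> ?N \<kappa>"
    using cauchy[of \<kappa>] by blast
  obtain y where y: "P y" "P0 y"
    using eventually_happens'[OF F_bot eventually_conj[OF P(1) P0(1)]] by blast
  then have yc: "y \<in> carrier G" and "y \<otimes> inv g \<in> ?N (\<lambda>_. 0)" using P0(2) \<open>P0 g\<close> by auto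
  then obtain n where n: "y \<otimes> inv g \<in> ?K n" by (auto simp: sequence_neighbourhood_def)
  obtain x where x: "P x" "\<forall>a\<in>?K (n + n). inv (g \<otimes> a) \<otimes> x \<notin> ?N (w n)"
    using eventually_happens'[OF F_bot eventually_conj[OF P(1) w[of n]]] by blast
  have xc: "x \<in> carrier G" and "x \<otimes> inv y \<in> ?N \<kappa>" using P(2) x(1) y(1) by auto
  then obtain m where "x \<otimes> inv y \<in> tail_products u \<kappa> m" by (auto simp: sequence_neighbourhood_def)
  then have "x \<otimes> inv y \<in> tail_products u \<kappa> (n + m)" by (rule tail_products_mono[rotated]) simp
  then obtain c z where cz: "c \<in> tail_products u \<kappa> n" "z \<in> tail_products u (\<lambda>i. \<kappa> (n + i)) m"
    "x \<otimes> inv y = c \<otimes> z" by (auto simp: tail_products_add)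
  have carr: "c \<in> carrier G" "z \<in> carrier G" using cz tail_products_carrier by auto
  have "c \<in> ?K n" using cz(1) by (rule tail_products_antimono[rotated]) simp
  then have mem: "(y \<otimes> inv g) \<otimes> c \<in> ?K (n + n)" using n by (auto simp: tail_products_add)
  have "z \<in> tail_products u (w n) m" using cz(2) by (rule tail_products_antimono[rotated]) (rule \<kappa>)
  then have "z \<in> ?N (w n)" by (auto simp: sequence_neighbourhood_def)
  moreover have "inv (g \<otimes> ((y \<otimes> inv g) \<otimes> c)) \<otimes> x = z"
  proof -
    have "g \<otimes> ((y \<otimes> inv g) \<otimes> c) = (g \<otimes> inv g) \<otimes> (y \<otimes> c)"
      using g yc carr by (simp only: m_ac inv_closed m_closed)
    then have 1: "g \<otimes> ((y \<otimes> inv g) \<otimes> c) = y \<otimes> c" using g yc carr by simp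
    have "x = (x \<otimes> inv y) \<otimes> y" using xc yc by (simp add: m_assoc)
    also have "\<dots> = (y \<otimes> c) \<otimes> z" unfolding cz(3) using yc carr by (simp only: m_ac m_closed)
    finally have "inv (y \<otimes> c) \<otimes> x = inv (y \<otimes> c) \<otimes> ((y \<otimes> c) \<otimes> z)" by simp
    also have "\<dots> = (inv (y \<otimes> c) \<otimes> (y \<otimes> c)) \<otimes> z" using yc carr by (simp only: m_assoc m_closed inv_closed)
    also have "\<dots> = z" using yc carr by simp
    finally show ?thesis by (simp only: 1)
  qed
  ultimately show False using x(2) mem by force
qed

text \<open>
  The kernel of a continuous character is open, hence contains a tail of \<open>u\<close> and the subgroup
  generated by it. Conversely the subgroup generated by a tail is a neighbourhood of \<open>\<one>\<close>, so every
  character that is trivial on it is continuous, and these characters separate it from the points outside.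
\<close>

proposition von_neumann_radical_sequence_topology:
  assumes exp: "M > 0" "\<And>x. x \<in> carrier G \<Longrightarrow> x [^] (M::nat) = \<one>"
  shows "von_neumann_radical G (sequence_topology u) = (\<Inter>m. generate G (u ` {m..}))"
proof (intro equalityI subsetI)
  fix x assume x: "x \<in> von_neumann_radical G (sequence_topology u)"
  have "(\<lambda>_. 1) \<in> continuous_characters G (sequence_topology u)"
    by (auto simp: continuous_characters_def hom_def)
  with x have xc: "x \<in> carrier G" unfolding von_neumann_radical_def kernel_def by blast
  have "x \<in> generate G (u ` {m..})" for m
  proof (rule ccontr)
    assume nin: "x \<notin> generate G (u ` {m..})"
    have "subgroup (generate G (u ` {m..})) G" using u by (intro generate_is_subgroup) auto
    from exists_separating_character[OF exp this xc nin] obtain \<phi> where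
      \<phi>: "\<phi> \<in> hom G circle_group" "\<And>h. h \<in> generate G (u ` {m..}) \<Longrightarrow> \<phi> h = 1" "\<phi> x \<noteq> 1" by blast
    obtain W where W: "openin (sequence_topology u) W" "\<one> \<in> W"
        "\<forall>w\<in>W. inv \<one> \<otimes> w \<in> sequence_neighbourhood u (\<lambda>_. m)"
      using sequence_neighbourhood_open[OF one_closed] by blast
    have "W \<subseteq> carrier G"
      using openin_subset[OF W(1)] topspace_base_topology[OF identity_base_sequence_neighbourhoods]
      by (simp add: sequence_topology_def)
    then have "\<phi> w = 1" if "w \<in> W" for w
      using W(3) that by (intro \<phi>(2)) (force simp: sequence_neighbourhood_const)
    then have "\<phi> \<in> continuous_characters G (sequence_topology u)"
      using continuous_hom_if_trivial_nearby[OF topological_abelian_group_sequence_topology \<phi>(1) W(1,2)] by blast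
    then show False using x \<phi>(3) by (auto simp: von_neumann_radical_def kernel_def)
  qed
  then show "x \<in> (\<Inter>m. generate G (u ` {m..}))" by blast
next
  fix x assume x: "x \<in> (\<Inter>m. generate G (u ` {m..}))"
  have "x \<in> kernel G circle_group \<phi>" if \<phi>: "\<phi> \<in> continuous_characters G (sequence_topology u)" for \<phi>
  proof -
    have hom: "\<phi> \<in> hom G circle_group" using \<phi> by (simp add: continuous_characters_def)
    interpret \<phi>: group_hom G circle_group \<phi>
      using hom comm_group_circle_group by (simp add: group_hom_def group_hom_axioms_def comm_group_def is_group)
    have "openin (sequence_topology u) {x \<in> carrier G. \<phi> x = 1}"
      by (rule open_kernel_continuous_character[OF exp topological_abelian_group_sequence_topology \<phi>])
    moreover have "\<one> \<in> {x \<in> carrier G. \<phi> x = 1}" using \<phi>.hom_one by simp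
    ultimately obtain k where k: "\<forall>v\<in>sequence_neighbourhood u k. \<one> \<otimes> v \<in> {x \<in> carrier G. \<phi> x = 1}"
      unfolding sequence_topology_def openin_base_topology[OF identity_base_sequence_neighbourhoods] by blast
    have "u ` {k 0..} \<subseteq> kernel G circle_group \<phi>"
    proof
      fix v assume v: "v \<in> u ` {k 0..}"
      then have "v \<in> sequence_neighbourhood u k"
        using signed_tail_in_neighbourhood[of k] by (auto simp: signed_tail_def)
      then show "v \<in> kernel G circle_group \<phi>" using k v u by (auto simp: kernel_def)
    qed
    then have "generate G (u ` {k 0..}) \<subseteq> kernel G circle_group \<phi>"
      by (rule generate_subgroup_incl) (rule \<phi>.subgroup_kernel)
    then show ?thesis using x by blast
  qed
  then show "x \<in> von_neumann_radical G (sequence_topology u)"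
    by (simp add: von_neumann_radical_def)
qed

end

section \<open>Independent sequences\<close>

text \<open>
  The \<open>e n\<close> have order \<open>N\<close> and their cyclic subgroups form a direct sum. Phrasing this through
  generated subgroups avoids the bookkeeping of coordinates.
\<close>

definition independent_sequence :: "nat \<Rightarrow> (nat \<Rightarrow> 'a) \<Rightarrow> bool" where
  "independent_sequence N e \<longleftrightarrow> (\<forall>n. e n \<in> carrier G \<and> e n [^] N = \<one>) \<and>
     (\<forall>n. \<forall>c::int. e n [^] c \<in> generate G (e ` (- {n})) \<longrightarrow> int N dvd c)"

lemma generate_mono: "A \<subseteq> B \<Longrightarrow> x \<in> generate G A \<Longrightarrow> x \<in> generate G B"
  by (rule mono_generate[THEN subsetD])

lemma generate_mult: "x \<in> generate G A \<Longrightarrow> y \<in> generate G A \<Longrightarrow> x \<otimes> y \<in> generate G A"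
  by (rule generate.eng)

lemma generate_inv: "A \<subseteq> carrier G \<Longrightarrow> x \<in> generate G A \<Longrightarrow> inv x \<in> generate G A"
  by (rule generate_m_inv_closed)

lemma generate_int_pow: "A \<subseteq> carrier G \<Longrightarrow> x \<in> generate G A \<Longrightarrow> x [^] (c::int) \<in> generate G A"
  by (rule subgroup_int_pow_closed[OF generate_is_subgroup])

lemma generate_cancel_left:
  assumes "A \<subseteq> carrier G" "a \<in> generate G A" "a \<otimes> x \<in> generate G A" "x \<in> carrier G"
  shows "x \<in> generate G A"
proof -
  have a: "a \<in> carrier G" using assms by (auto dest: generate_in_carrier)
  have "inv a \<otimes> (a \<otimes> x) \<in> generate G A"
    by (rule generate_mult[OF generate_inv[OF assms(1,2)] assms(3)])
  moreover have "inv a \<otimes> (a \<otimes> x) = x" using a assms(4) by (simp add: m_assoc[symmetric])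
  ultimately show ?thesis by simp
qed

lemma generate_cancel_right:
  assumes "A \<subseteq> carrier G" "a \<in> generate G A" "x \<otimes> a \<in> generate G A" "x \<in> carrier G"
  shows "x \<in> generate G A"
  using assms generate_cancel_left[of A a x] generate_in_carrier[of A a] by (simp add: m_comm)

lemma finprod_in_generate:
  assumes "finite B" "\<And>i. i \<in> B \<Longrightarrow> e i \<in> carrier G"
  shows "finprod G e B \<in> generate G (e ` B)"
  using assms
proof (induction B)
  case (insert b B)
  have "finprod G e B \<in> generate G (e ` B)" using insert by simp
  then have "finprod G e B \<in> generate G (e ` insert b B)" by (rule generate_mono[rotated]) auto
  then have "e b \<otimes> finprod G e B \<in> generate G (e ` insert b B)"
    by (intro generate_mult) (auto intro: generate.incl)
  moreover have "finprod G e (insert b B) = e b \<otimes> finprod G e B"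
    using insert by (intro finprod_insert) auto
  ultimately show ?case by simp
qed (auto intro: generate.one)

lemma torsion_subgroup: "subgroup {x \<in> carrier G. x [^] (N::nat) = \<one>} G"
  by (rule subgroupI) (auto simp: nat_pow_inv pow_mult_distrib m_comm)

text \<open>
  Pull back the unit vectors. The \<open>n\<close>-th coordinate is a homomorphism that vanishes on all unit
  vectors but the \<open>n\<close>-th.
\<close>

lemma independent_sequence_of_iso:
  assumes K: "subgroup K G" and iso: "G\<lparr>carrier := K\<rparr> \<cong> cyclic_group_power N"
  shows "\<exists>e. independent_sequence N e"
proof -
  let ?K = "G\<lparr>carrier := K\<rparr>" and ?C = "cyclic_group_power N" and ?Z = "integer_mod_group N"
  obtain f where f: "f \<in> iso ?K ?C" using iso by (auto simp: is_iso_def)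
  have grp: "group ?K" using K by (rule subgroup_imp_group)
  have bij: "bij_betw f K (carrier ?C)" using f by (simp add: iso_def)
  have f_mult: "f (x \<otimes> y) = f x \<otimes>\<^bsub>?C\<^esub> f y" if "x \<in> K" "y \<in> K" for x y
    using f that by (auto simp: iso_def hom_def)
  have coord: "(\<lambda>x. f x n) \<in> hom ?K ?Z" for n
  proof (rule homI)
    fix x y assume xy: "x \<in> carrier ?K" "y \<in> carrier ?K"
    then have "f x \<in> carrier ?C" using bij by (auto simp: bij_betw_def)
    then show "f x n \<in> carrier ?Z" by (auto simp: cyclic_group_power_def carrier_sum_group)
    show "f (x \<otimes>\<^bsub>?K\<^esub> y) n = f x n \<otimes>\<^bsub>?Z\<^esub> f y n"
      using xy by (simp add: f_mult cyclic_group_power_def)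
  qed
  have coord_hom: "group_hom ?K ?Z (\<lambda>x. f x n)" for n
    using grp coord by (simp add: group_hom_def group_hom_axioms_def)
  have f_pow: "f (x [^] c) n = (c * f x n) mod int N" if "x \<in> K" for x n and c :: int
    using group_hom.hom_int_pow[OF coord_hom[of n], of x c] that int_pow_consistent[OF K that, of c]
    by (simp add: int_pow_integer_mod_group)
  define \<delta> where "\<delta> n = (\<lambda>j::nat. if j = n then 1 mod int N else 0)" for n
  have \<delta>: "\<delta> n \<in> carrier ?C" for n
  proof -
    have "finite {i. \<delta> n i \<noteq> 0}" by (rule finite_subset[of _ "{n}"]) (auto simp: \<delta>_def)
    moreover have "\<delta> n j \<in> carrier ?Z" for j
      by (simp add: \<delta>_def carrier_integer_mod_group)
    ultimately show ?thesis by (simp add: cyclic_group_power_def carrier_sum_group PiE_iff)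
  qed
  define e where "e n = inv_into K f (\<delta> n)" for n
  have e: "e n \<in> K" "f (e n) = \<delta> n" for n
    using \<delta>[of n] bij_betw_imp_surj_on[OF bij] unfolding e_def
    by (auto intro: inv_into_into f_inv_into_f)
  have eG: "e n \<in> carrier G" for n using e(1) subgroup.mem_carrier[OF K] by blast
  have pow_K: "x [^] (c::int) \<in> K" if "x \<in> K" for x c
    using K that by (rule subgroup_int_pow_closed)
  have "e n [^] N = \<one>" for n
  proof -
    have "f (e n [^] int N) = f \<one>"
    proof
      fix j
      have "f \<one> j = 0" using group_hom.hom_one[OF coord_hom[of j]] by simp
      then show "f (e n [^] int N) j = f \<one> j" by (simp add: f_pow[OF e(1)])
    qed
    then have "e n [^] int N = \<one>"
      using bij pow_K[OF e(1)] subgroup.one_closed[OF K] by (auto simp: bij_betw_def inj_on_def)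
    then show ?thesis by (simp add: int_pow_int)
  qed
  moreover have "int N dvd c" if c: "e n [^] c \<in> generate G (e ` (- {n}))" for n and c :: int
  proof -
    let ?L = "{x \<in> K. f x n = 0}"
    have "subgroup ?L G"
    proof (rule subgroupI)
      show "?L \<subseteq> carrier G" using subgroup.subset[OF K] by blast
      show "?L \<noteq> {}" using subgroup.one_closed[OF K] group_hom.hom_one[OF coord_hom[of n]] by auto
      show "inv x \<in> ?L" if "x \<in> ?L" for x
        using that f_pow[of x "-1" n] pow_K[of x "-1"] subgroup.mem_carrier[OF K]
        by (auto simp: int_pow_neg)
      show "x \<otimes> y \<in> ?L" if "x \<in> ?L" "y \<in> ?L" for x y
        using that subgroup.m_closed[OF K] by (auto simp: f_mult cyclic_group_power_def)
    qed
    moreover have "e ` (- {n}) \<subseteq> ?L" using e by (auto simp: \<delta>_def)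
    ultimately have "generate G (e ` (- {n})) \<subseteq> ?L" by (rule generate_subgroup_incl[rotated])
    with c have "f (e n [^] c) n = 0" by blast
    then show ?thesis using e by (simp add: f_pow \<delta>_def mod_mult_right_eq dvd_eq_mod_eq_0)
  qed
  ultimately show ?thesis using eG unfolding independent_sequence_def by blast
qed

context
  fixes N :: nat and e :: "nat \<Rightarrow> 'a"
  assumes e: "independent_sequence N e"
begin

lemma independent_closed: "e n \<in> carrier G"
  using e by (simp add: independent_sequence_def)

lemma independent_image: "e ` I \<subseteq> carrier G"
  using independent_closed by blast

lemma independent_pow: "e n [^] N = \<one>"
  using e by (simp add: independent_sequence_def)

lemma independent_dvd:
  assumes "n \<notin> I" "e n [^] (c::int) \<in> generate G (e ` I)"
  shows "int N dvd c"
proof -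
  have "e n [^] c \<in> generate G (e ` (- {n}))"
    by (rule generate_mono[OF _ assms(2)]) (use assms(1) in auto)
  then show ?thesis using e by (simp add: independent_sequence_def)
qed

lemma int_pow_eq_one_if_dvd: "x \<in> carrier G \<Longrightarrow> x [^] N = \<one> \<Longrightarrow> int N dvd c \<Longrightarrow> x [^] c = \<one>"
  by (auto elim!: dvdE simp: int_pow_pow[symmetric] int_pow_int)

lemma independent_disjoint:
  assumes "finite I" "I \<inter> J = {}" "x \<in> generate G (e ` I)" "x \<in> generate G (e ` J)"
  shows "x = \<one>"
  using assms
proof (induction I)
  case empty
  then show ?case by (simp add: generate_empty)
next
  case (insert i I)
  from insert.prems(2) obtain a and c :: int where a: "a \<in> generate G (e ` I)" "x = a \<otimes> e i [^] c"
    using generate_insert_iff[OF independent_image independent_closed] by auto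
  have "a \<in> generate G (e ` (I \<union> J))" "x \<in> generate G (e ` (I \<union> J))"
    by (rule generate_mono[OF _ a(1)], blast, rule generate_mono[OF _ insert.prems(3)], blast)
  then have "e i [^] c \<in> generate G (e ` (I \<union> J))"
    using a(2) independent_closed by - (rule generate_cancel_left[OF independent_image, of a], auto)
  then have "int N dvd c" using insert by (intro independent_dvd[of i "I \<union> J"]) auto
  then have "x = a"
    using a independent_pow independent_closed generate_in_carrier[OF independent_image a(1)]
    by (simp add: int_pow_eq_one_if_dvd)
  then show ?case using insert a by auto
qed

text \<open>
  The element \<open>e (a n)\<close> occurs in the \<open>n\<close>-th quotient only, so modulo all the other members of \<open>e\<close> a
  power of this quotient is a power of \<open>e (a n)\<close>.
\<close>

lemma independent_differences:
  assumes inj: "inj a" "inj b" and disj: "\<And>m n. a m \<noteq> b n"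
  shows "independent_sequence N (\<lambda>n. e (a n) \<otimes> inv e (b n))"
  unfolding independent_sequence_def
proof (intro conjI allI impI)
  note [simp] = independent_closed
  fix n
  show "e (a n) \<otimes> inv e (b n) \<in> carrier G" by simp
  show "(e (a n) \<otimes> inv e (b n)) [^] N = \<one>"
    by (simp add: pow_mult_distrib m_comm nat_pow_inv independent_pow)
  fix c :: int
  assume c: "(e (a n) \<otimes> inv e (b n)) [^] c \<in> generate G ((\<lambda>n. e (a n) \<otimes> inv e (b n)) ` (- {n}))"
  let ?Q = "generate G (e ` (- {a n}))"
  have in_Q: "e j \<in> ?Q" if "j \<noteq> a n" for j
    using that by (auto intro: generate.incl)
  have "generate G ((\<lambda>n. e (a n) \<otimes> inv e (b n)) ` (- {n})) \<subseteq> ?Q"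
  proof (rule generate_subgroup_incl)
    show "(\<lambda>n. e (a n) \<otimes> inv e (b n)) ` (- {n}) \<subseteq> ?Q"
      using inj(1) disj disj[THEN not_sym] by (auto simp: inj_eq intro!: generate_mult generate_inv[OF independent_image] in_Q)
  qed (intro generate_is_subgroup independent_image)
  with c have "e (a n) [^] c \<otimes> (inv e (b n)) [^] c \<in> ?Q"
    by (auto simp: int_pow_distrib)
  moreover have "(inv e (b n)) [^] c \<in> ?Q"
    using disj[of n n] by (intro generate_int_pow[OF independent_image] generate_inv[OF independent_image] in_Q) auto
  ultimately have "e (a n) [^] c \<in> ?Q"
    by - (rule generate_cancel_right[OF independent_image, of "(inv e (b n)) [^] c"], auto)
  then show "int N dvd c" by (intro independent_dvd[of "a n" "- {a n}"]) auto
qed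

text \<open>
  The intersection over all tails can be strictly larger than \<open>H\<close>; for instance, if \<open>H\<close> is the
  subgroup of exponent sum \<open>0\<close> in the direct sum spanned by \<open>e\<close>, every tail together with \<open>H\<close>
  generates the whole sum. The remedy is to pass to quotients of members of \<open>e\<close>. The group generated by \<open>H\<close> and
  \<open>e\<close> is countable; enumerate its elements outside \<open>H\<close> as \<open>s 0, s 1, \<dots>\<close> and choose for each of them a
  character that is trivial on \<open>H\<close> but not at this element. The first \<open>n + 1\<close> of these characters take finitely
  many values, so by the pigeonhole principle two members of \<open>e\<close> have the same values, and their
  quotient is killed by all of them. Taking these as the new sequence, the character of \<open>s t\<close>
  kills \<open>H\<close> and the tail from \<open>t\<close> on, which keeps \<open>s t\<close> out of the intersection.
\<close>

proposition independent_modulo_countable_subgroup: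
  assumes exp: "M > 0" "\<And>x. x \<in> carrier G \<Longrightarrow> x [^] (M::nat) = \<one>"
    and H: "subgroup H G" "countable H"
  shows "\<exists>e'. independent_sequence N e' \<and> (\<Inter>m. generate G (H \<union> e' ` {m..})) = H"
proof -
  define S where "S = generate G (H \<union> range e) - H"
  have HG: "H \<subseteq> carrier G" using H(1) by (rule subgroup.subset)
  have SG0: "H \<union> range e \<subseteq> carrier G" using HG independent_image by simp
  have "countable S"
  proof -
    have ne: "H \<union> range e \<noteq> {}" and cnt: "countable (H \<union> range e)" using H by auto
    have "range (from_nat_into (H \<union> range e)) = H \<union> range e"
      using ne cnt by (rule range_from_nat_into)
    moreover have "from_nat_into (H \<union> range e) n \<in> carrier G" for n
      using from_nat_into[OF ne, of n] SG0 by (rule subsetD[rotated])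
    ultimately have "countable (generate G (H \<union> range e))"
      using countable_generate_range[of "from_nat_into (H \<union> range e)"] by simp
    then show ?thesis by (simp add: S_def)
  qed
  define s where "s = from_nat_into S"
  have SG: "x \<in> carrier G" if "x \<in> S" for x
    using that generate_in_carrier[OF SG0] by (simp add: S_def)
  have "\<forall>x\<in>S. \<exists>\<phi>. \<phi> \<in> hom G circle_group \<and> (\<forall>h\<in>H. \<phi> h = 1) \<and> \<phi> x \<noteq> 1"
  proof
    fix x assume x: "x \<in> S"
    then have "x \<notin> H" by (simp add: S_def)
    from exists_separating_character[OF exp H(1) SG[OF x] this]
    show "\<exists>\<phi>. \<phi> \<in> hom G circle_group \<and> (\<forall>h\<in>H. \<phi> h = 1) \<and> \<phi> x \<noteq> 1"
      by (simp only: Bex_def)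
  qed
  then obtain \<psi> where "\<forall>x\<in>S. \<psi> x \<in> hom G circle_group \<and> (\<forall>h\<in>H. \<psi> x h = 1) \<and> \<psi> x x \<noteq> 1"
    by (elim bchoice[THEN exE])
  then have \<psi>: "\<psi> x \<in> hom G circle_group" "\<And>h. h \<in> H \<Longrightarrow> \<psi> x h = 1" "\<psi> x x \<noteq> 1" if "x \<in> S" for x
    using that by simp_all
  have \<psi>_hom: "group_hom G circle_group (\<psi> x)" if "x \<in> S" for x
    using \<psi>(1)[OF that] comm_group_circle_group
    by (simp add: group_hom_def group_hom_axioms_def comm_group_def is_group)
  have \<psi>_root: "\<psi> x y ^ M = 1" if "x \<in> S" "y \<in> carrier G" for x y
    using group_hom.hom_nat_pow[OF \<psi>_hom[OF that(1)] that(2), of M]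
      group_hom.hom_one[OF \<psi>_hom[OF that(1)]] exp(2)[OF that(2)]
    by (simp add: circle_group_pow)
  have "\<exists>l l'. l \<noteq> l' \<and> (\<forall>t\<le>n. s t \<in> S \<longrightarrow> \<psi> (s t) (e (prod_encode (n, l))) = \<psi> (s t) (e (prod_encode (n, l'))))" for n
  proof -
    \<comment> \<open>Distinct n search disjoint infinite blocks of e, indexed through \<^term>\<open>prod_encode\<close>.\<close>
    let ?D = "{t. t \<le> n \<and> s t \<in> S}"
    let ?f = "\<lambda>l. \<lambda>t\<in>?D. \<psi> (s t) (e (prod_encode (n, l)))"
    have fin: "finite (?D \<rightarrow>\<^sub>E {z::complex. z ^ M = 1})"
      using exp(1) by (intro finite_PiE) (auto simp: finite_roots_unity)
    have "range ?f \<subseteq> ?D \<rightarrow>\<^sub>E {z. z ^ M = 1}"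
      by (rule image_subsetI)
        (simp add: restrict_PiE_iff \<psi>_root independent_closed)
    then have "finite (range ?f)" using fin by (rule finite_subset)
    then have "\<not> inj ?f" using range_inj_infinite[of ?f] by (rule contrapos_pn)
    then have "\<exists>l l'. ?f l = ?f l' \<and> l \<noteq> l'"
      by (simp only: inj_def not_all not_imp)
    then obtain l l' where ll: "?f l = ?f l'" "l \<noteq> l'" by (elim exE conjE)
    have "\<psi> (s t) (e (prod_encode (n, l))) = \<psi> (s t) (e (prod_encode (n, l')))" if "t \<le> n" "s t \<in> S" for t
      using fun_cong[OF ll(1), of t] that by simp
    with ll(2) show ?thesis by (intro exI[of _ l] exI[of _ l']) simp
  qed
  then have "\<forall>n. \<exists>p. fst p \<noteq> snd p \<and> (\<forall>t\<le>n. s t \<in> S \<longrightarrow>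
      \<psi> (s t) (e (prod_encode (n, fst p))) = \<psi> (s t) (e (prod_encode (n, snd p))))" by simp
  then obtain p where p: "\<forall>n. fst (p n) \<noteq> snd (p n) \<and> (\<forall>t\<le>n. s t \<in> S \<longrightarrow>
      \<psi> (s t) (e (prod_encode (n, fst (p n)))) = \<psi> (s t) (e (prod_encode (n, snd (p n)))))"
    by (elim choice[THEN exE])
  define a b where "a n = prod_encode (n, fst (p n))" and "b n = prod_encode (n, snd (p n))" for n
  define e' where "e' n = e (a n) \<otimes> inv e (b n)" for n
  have e'G: "e' n \<in> carrier G" for n by (simp add: e'_def independent_closed)
  have "independent_sequence N (\<lambda>n. e (a n) \<otimes> inv e (b n))"
    using p by (intro independent_differences injI) (auto simp: a_def b_def)
  then have "independent_sequence N e'" by (simp add: e'_def[abs_def])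
  moreover have "(\<Inter>m. generate G (H \<union> e' ` {m..})) = H"
  proof (intro equalityI subsetI)
    fix x assume x: "x \<in> (\<Inter>m. generate G (H \<union> e' ` {m..}))"
    show "x \<in> H"
    proof (rule ccontr)
      assume "x \<notin> H"
      have "e' n \<in> generate G (H \<union> range e)" for n
        unfolding e'_def by (intro generate_mult generate_inv[OF SG0] generate.incl) auto
      then have "generate G (H \<union> e' ` {0..}) \<subseteq> generate G (H \<union> range e)"
        by (intro generate_subgroup_incl generate_is_subgroup[OF SG0]) (auto intro: generate.incl)
      moreover have "x \<in> generate G (H \<union> e' ` {0..})" using x by (rule INT_D) simp
      ultimately have "x \<in> S" using \<open>x \<notin> H\<close> by (simp add: S_def subsetD)
      obtain t where t: "s t = x"
        using from_nat_into_surj[OF \<open>countable S\<close> \<open>x \<in> S\<close>] unfolding s_def by (elim exE)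
      interpret \<psi>: group_hom G circle_group "\<psi> x" using \<open>x \<in> S\<close> by (rule \<psi>_hom)
      have "\<psi> x (e' n) = 1" if "n \<ge> t" for n
      proof -
        have "\<psi> x (e (a n)) = \<psi> x (e (b n))"
          using p[THEN spec, THEN conjunct2, THEN spec, of t n] that t \<open>x \<in> S\<close>
          by (simp add: a_def b_def)
        then have "\<psi> x (e' n) = \<psi> x (e (b n)) * \<psi> x (inv e (b n))"
          unfolding e'_def by (subst \<psi>.hom_mult) (simp_all add: independent_closed)
        also have "\<dots> = \<psi> x (e (b n) \<otimes> inv e (b n))"
          by (subst \<psi>.hom_mult) (simp_all add: independent_closed)
        also have "\<dots> = 1" using independent_closed \<psi>.hom_one by simp
        finally show ?thesis .
      qed
      then have "H \<union> e' ` {t..} \<subseteq> kernel G circle_group (\<psi> x)"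
        using HG e'G \<psi>(2)[OF \<open>x \<in> S\<close>] by (auto simp add: kernel_def)
      then have "generate G (H \<union> e' ` {t..}) \<subseteq> kernel G circle_group (\<psi> x)"
        by (rule generate_subgroup_incl) (rule \<psi>.subgroup_kernel)
      moreover have "x \<in> generate G (H \<union> e' ` {t..})" using x by (rule INT_D) simp
      ultimately have "x \<in> kernel G circle_group (\<psi> x)" by (rule subsetD)
      then have "\<psi> x x = 1" by (simp add: kernel_def)
      then show False using \<psi>(3)[OF \<open>x \<in> S\<close>] by simp
    qed
  qed (auto intro: generate.incl)
  ultimately show ?thesis by (intro exI[of _ e'] conjI)
qed

end

section \<open>A null sequence whose tails generate groups shrinking to a given subgroup\<close>

text \<open>
  Here the sequence alternates between \<open>e\<close> (at even positions) and \<open>d\<close> (at odd positions). In a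
  word of the neighbourhood given by \<open>k\<close> only the first \<open>t\<close> letters can have a position below \<open>k t\<close>.
  Collecting the indices of the letters from \<open>e\<close> into a set \<open>J\<close>, fewer than \<open>t + 1\<close> of them are
  small in this sense.
\<close>

lemma tail_products_decomposition:
  assumes G: "\<And>n. e n \<in> carrier G" "\<And>n. d n \<in> carrier G"
    and k: "mono k" "k 0 = 2 * p"
    and x: "x \<in> tail_products (\<lambda>m. if even m then e (m div 2) else d (m div 2)) k n"
  shows "\<exists>J L. finite J \<and> J \<subseteq> {p..} \<and> x \<in> generate G (d ` {p..<L} \<union> e ` J) \<and>
    (\<forall>t. card (J \<inter> {j. 2 * j < k t}) \<le> min t n)"
  using x
proof (induction n arbitrary: x)
  case 0
  then show ?case by (intro exI[of _ "{}"]) (auto intro: generate.one)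
next
  case (Suc n)
  let ?u = "\<lambda>m. if even m then e (m div 2) else d (m div 2)"
  have sub: "d ` A \<union> e ` B \<subseteq> carrier G" for A B using G by auto
  obtain y a where y: "y \<in> tail_products ?u k n" and a: "a \<in> signed_tail ?u (k n)" and xya: "x = y \<otimes> a"
    using Suc.prems by auto
  obtain J L where J: "finite J" "J \<subseteq> {p..}" "y \<in> generate G (d ` {p..<L} \<union> e ` J)"
    and card: "\<And>t. card (J \<inter> {j. 2 * j < k t}) \<le> min t n"
    using Suc.IH[OF y] by auto
  consider "a = \<one>" | m where "m \<ge> k n" "a = ?u m \<or> a = inv (?u m)"
    using a by (auto simp: signed_tail_def)
  then show ?case
  proof cases
    case 1
    have "y \<in> carrier G" using generate_in_carrier[OF sub J(3)] .
    then have "x \<in> generate G (d ` {p..<L} \<union> e ` J)" using 1 xya J(3) by simp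
    moreover have "card (J \<inter> {j. 2 * j < k t}) \<le> min t (Suc n)" for t using card[of t] by simp
    ultimately show ?thesis using J by blast
  next
    case (2 m)
    have "k 0 \<le> k n" using k(1) by (simp add: monoD)
    then have m: "2 * p \<le> m" using 2(1) k(2) by simp
    show ?thesis
    proof (cases "even m")
      case True
      then obtain j where j: "m = 2 * j" by (elim evenE)
      let ?Q = "generate G (d ` {p..<L} \<union> e ` insert j J)"
      have "e j \<in> ?Q" by (intro generate.incl) auto
      then have "a \<in> ?Q"
        using 2(2) True j generate_inv[OF sub \<open>e j \<in> ?Q\<close>] by auto
      moreover have "y \<in> ?Q" by (rule generate_mono[OF _ J(3)]) auto
      ultimately have "x \<in> ?Q" unfolding xya by (intro generate_mult)
      moreover have "insert j J \<subseteq> {p..}" using J(2) m j by simp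
      moreover have "card (insert j J \<inter> {i. 2 * i < k t}) \<le> min t (Suc n)" for t
      proof (cases "t \<le> n")
        case True
        then have "k t \<le> m" using k(1) 2(1) by (meson monoD order_trans)
        then have "insert j J \<inter> {i. 2 * i < k t} = J \<inter> {i. 2 * i < k t}" using j by auto
        then show ?thesis using card[of t] by simp
      next
        case False
        have "card (insert j J \<inter> {i. 2 * i < k t}) \<le> card (insert j (J \<inter> {i. 2 * i < k t}))"
          using J(1) by (intro card_mono) auto
        also have "\<dots> \<le> Suc (card (J \<inter> {i. 2 * i < k t}))"
          using J(1) by (intro card_insert_le_m1) auto
        finally show ?thesis using card[of t] False by simp
      qed
      ultimately show ?thesis using J(1) by (intro exI[of _ "insert j J"] exI[of _ L]) simp
    next
      case False
      then obtain j where j: "m = Suc (2 * j)" by (elim oddE) simp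
      let ?Q = "generate G (d ` {p..<max L (Suc j)} \<union> e ` J)"
      have "d j \<in> ?Q" using m j by (intro generate.incl) auto
      then have "a \<in> ?Q"
        using 2(2) False j by (auto intro!: generate_inv[OF sub])
      moreover have "y \<in> ?Q" by (rule generate_mono[OF _ J(3)]) auto
      ultimately have "x \<in> ?Q" unfolding xya by (intro generate_mult)
      moreover have "card (J \<inter> {i. 2 * i < k t}) \<le> min t (Suc n)" for t using card[of t] by simp
      ultimately show ?thesis using J(1,2) by (intro exI[of _ J] exI[of _ "max L (Suc j)"]) simp
    qed
  qed
qed

text \<open>
  Enumerate \<open>H\<close> as \<open>h\<close> with every element repeated infinitely often, and let \<open>d n\<close> be \<open>h n\<close> times the
  product of \<open>e j\<close> over a block \<open>B n\<close> of \<open>n + 1\<close> indices. The blocks are disjoint and are placed so far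
  out that \<open>B n\<close> is not involved in those products of \<open>h 0, \<dots>, h n\<close> that belong to the span of \<open>e\<close>; this is possible since
  \<open>h 0, \<dots>, h n\<close> generate a finite group. Any tail of the sequence \<open>e 0, d 0, e 1, d 1, \<dots>\<close> generates
  every \<open>h \<in> H\<close>, as \<open>d n\<close> divided by a product of members of \<open>e\<close>, and it lies in the group generated
  by \<open>H\<close> and a tail of \<open>e\<close>. Hence the tails intersect in \<open>H\<close>.

  For the separation of \<open>g \<noteq> \<one>\<close> from \<open>\<one>\<close>, write an element of a neighbourhood as a product of powers
  of members of \<open>d\<close> and of members of \<open>e\<close> with indices in \<open>J\<close>. For fast growing \<open>k\<close> the set \<open>J\<close> is too small to
  contain any block \<open>B L\<close>. If this product is \<open>g\<close>, consider the largest \<open>L\<close> for which a power of \<open>d L\<close> occurs and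
  some \<open>l \<in> B L\<close> outside \<open>J\<close>: nothing can cancel the contribution of \<open>e l\<close>, so the power of \<open>d L\<close> is
  trivial. Peeling off all members of \<open>d\<close> in this way leaves a product of late members of \<open>e\<close>, which is different
  from \<open>g\<close>.
\<close>

proposition exists_null_sequence_with_radical:
  assumes exp: "M > 0" "\<And>x. x \<in> carrier G \<Longrightarrow> x [^] (M::nat) = \<one>"
    and H: "subgroup H G" "countable H" "\<And>h. h \<in> H \<Longrightarrow> h [^] N = \<one>"
    and N: "N \<ge> 2" and e: "independent_sequence N e"
    and eH: "(\<Inter>m. generate G (H \<union> e ` {m..})) = H"
  shows "\<exists>u. (\<forall>n. u n \<in> carrier G) \<and> (\<forall>m. \<exists>n\<ge>m. u n \<noteq> \<one>) \<and>
    (\<forall>g\<in>carrier G. g \<noteq> \<one> \<longrightarrow> (\<exists>k. g \<notin> sequence_neighbourhood u k)) \<and>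
    (\<Inter>m. generate G (u ` {m..})) = H"
proof -
  note [simp] = independent_closed[OF e]
  have HG: "H \<subseteq> carrier G" using H(1) by (rule subgroup.subset)
  have Hne: "H \<noteq> {}" using subgroup.one_closed[OF H(1)] by blast
  define h where "h n = from_nat_into H (fst (prod_decode n))" for n
  have hH: "h n \<in> H" for n using from_nat_into[OF Hne] by (simp add: h_def)
  have hG [simp]: "h n \<in> carrier G" for n using hH HG by blast
  have h_often: "\<exists>n\<ge>m. h n = x" if "x \<in> H" for x m
  proof -
    obtain i where "from_nat_into H i = x" using from_nat_into_surj[OF H(2) \<open>x \<in> H\<close>] by blast
    then show ?thesis by (intro exI[of _ "prod_encode (i, m)"]) (simp add: h_def le_prod_encode_2)
  qed
  have sub: "h ` A \<union> e ` B \<subseteq> carrier G" for A B by auto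
  have "\<exists>s. \<forall>x\<in>generate G (h ` {..n}) \<inter> generate G (range e). x \<in> generate G (e ` {..<s})" for n
  proof -
    let ?X = "generate G (h ` {..n}) \<inter> generate G (range e)"
    have fin: "finite ?X" using finite_generate[OF _ _ exp, of "h ` {..n}"] by (simp add: image_subset_iff)
    have "\<forall>x\<in>?X. \<exists>s. x \<in> generate G (e ` {..<s})"
    proof
      fix x assume "x \<in> ?X"
      then obtain I where I: "finite I" "x \<in> generate G (e ` I)"
        using generate_finite_support[of x e UNIV] by auto
      then have "I \<subseteq> {..<Suc (Max I)}" by (auto simp: less_Suc_eq_le)
      then show "\<exists>s. x \<in> generate G (e ` {..<s})" using I(2) generate_mono[of "e ` I"] by (meson image_mono)
    qed
    then obtain r where r: "\<forall>x\<in>?X. x \<in> generate G (e ` {..<r x})" by (elim bchoice[THEN exE])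
    have "x \<in> generate G (e ` {..<Max (r ` ?X)})" if "x \<in> ?X" for x
    proof -
      have "r x \<le> Max (r ` ?X)" using fin that by auto
      then have "e ` {..<r x} \<subseteq> e ` {..<Max (r ` ?X)}" by auto
      then show ?thesis using r that generate_mono by blast
    qed
    then show ?thesis by blast
  qed
  then have "\<forall>n. \<exists>s. \<forall>x\<in>generate G (h ` {..n}) \<inter> generate G (range e). x \<in> generate G (e ` {..<s})"
    by (rule allI)
  then obtain s where s: "\<forall>n. \<forall>x\<in>generate G (h ` {..n}) \<inter> generate G (range e). x \<in> generate G (e ` {..<s n})"
    by (elim choice[THEN exE])
  define B where "B n = (\<lambda>l. prod_encode (n, max (s n) n + l)) ` {..n}" for n
  have finB [simp]: "finite (B n)" for n by (simp add: B_def)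
  have cardB: "card (B n) = Suc n" for n
    unfolding B_def by (subst card_image) (auto simp: inj_on_def)
  have B_ge: "s n \<le> j" "n \<le> j" if j: "j \<in> B n" for n j
  proof -
    obtain l where "j = prod_encode (n, max (s n) n + l)" using j by (auto simp: B_def)
    then have "max (s n) n + l \<le> j" using le_prod_encode_2 by simp
    then show "s n \<le> j" "n \<le> j" by simp_all
  qed
  have B_disjoint: "j \<notin> B m" if "j \<in> B n" "m \<noteq> n" for j m n
    using that by (auto simp: B_def)
  define d where "d n = h n \<otimes> finprod G e (B n)" for n
  have dG [simp]: "d n \<in> carrier G" for n by (simp add: d_def)
  have fin_in: "finprod G e A \<in> generate G (e ` A)" if "finite A" for A
    using that by (intro finprod_in_generate) auto
  have d_pow: "d n [^] N = \<one>" for n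
  proof -
    have "e ` B n \<subseteq> {x \<in> carrier G. x [^] N = \<one>}" by (auto simp: independent_pow[OF e])
    then have "generate G (e ` B n) \<subseteq> {x \<in> carrier G. x [^] N = \<one>}"
      by (intro generate_subgroup_incl torsion_subgroup)
    then have "finprod G e (B n) [^] N = \<one>" using fin_in[OF finB] by blast
    then show ?thesis using H(3)[OF hH] by (simp add: d_def pow_mult_distrib m_comm)
  qed
  \<comment> \<open>All that can interact with \<open>d n\<close>, except for the coordinate \<open>l \<in> B n\<close>.\<close>
  define Q where "Q n l = generate G (h ` {..n} \<union> e ` (- {l}))" for n l
  have e_in_Q: "int N dvd c" if l: "l \<in> B n" and c: "e l [^] c \<in> Q n l" for n l and c :: int
  proof -
    obtain a b where ab: "a \<in> generate G (h ` {..n})" "b \<in> generate G (e ` (- {l}))" "e l [^] c = a \<otimes> b"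
      using c generate_Un_iff[of "h ` {..n}" "e ` (- {l})" "e l [^] c"] sub unfolding Q_def by auto
    have aG: "a \<in> carrier G" using ab(1) by (rule generate_in_carrier[rotated]) auto
    have "b \<in> generate G (range e)" by (rule generate_mono[OF _ ab(2)]) auto
    moreover have "a \<otimes> b \<in> generate G (range e)"
      unfolding ab(3)[symmetric] by (intro generate_int_pow generate.incl) auto
    ultimately have "a \<in> generate G (range e)"
      using aG by - (rule generate_cancel_right[of "range e" b a], auto)
    then have "a \<in> generate G (e ` {..<s n})" using s ab(1) by blast
    then have "a \<in> generate G (e ` (- {l}))"
      by (rule generate_mono[rotated]) (use B_ge(1)[OF l] in auto)
    then have "e l [^] c \<in> generate G (e ` (- {l}))" using ab by (simp add: generate_mult)
    then show ?thesis by (intro independent_dvd[OF e, of l "- {l}"]) auto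
  qed
  have d_in_Q: "d n [^] c = \<one>" if l: "l \<in> B n" and c: "d n [^] c \<in> Q n l" for n l and c :: int
  proof -
    let ?y = "h n \<otimes> finprod G e (B n - {l})"
    have "finprod G e (insert l (B n - {l})) = e l \<otimes> finprod G e (B n - {l})"
      by (intro finprod_insert) auto
    then have "d n = e l \<otimes> ?y" using l by (simp add: d_def insert_absorb m_lcomm)
    then have eq: "d n [^] c = e l [^] c \<otimes> ?y [^] c" by (simp add: int_pow_distrib)
    have "h n \<in> Q n l" unfolding Q_def by (intro generate.incl) auto
    moreover have "finprod G e (B n - {l}) \<in> Q n l"
      unfolding Q_def by (rule generate_mono[OF _ fin_in]) auto
    ultimately have "?y [^] c \<in> Q n l"
      unfolding Q_def by (intro generate_int_pow[OF sub] generate_mult)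
    then have "e l [^] c \<in> Q n l"
      using c eq unfolding Q_def by - (rule generate_cancel_right[OF sub, of "?y [^] c"], auto)
    then have "int N dvd c" by (rule e_in_Q[OF l])
    then show ?thesis using d_pow by (intro int_pow_eq_one_if_dvd[OF e]) auto
  qed
  have peel: "g \<in> generate G (e ` J)"
    if g: "g \<in> generate G (h ` {..p} \<union> e ` {..<p})" and J: "\<And>n. \<not> B n \<subseteq> J"
      and gL: "g \<in> generate G (d ` {p..<L} \<union> e ` J)" for g p J L
    using gL
  proof (induction L)
    case (Suc L)
    show ?case
    proof (cases "p \<le> L")
      case False
      then show ?thesis using Suc by simp
    next
      case True
      then have "d ` {p..<Suc L} \<union> e ` J = insert (d L) (d ` {p..<L} \<union> e ` J)"
        by (auto simp: less_Suc_eq)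
      moreover have "d ` {p..<L} \<union> e ` J \<subseteq> carrier G" by auto
      ultimately obtain a and c :: int where a: "a \<in> generate G (d ` {p..<L} \<union> e ` J)" "g = a \<otimes> d L [^] c"
        using Suc.prems generate_insert_iff[OF _ dG] by metis
      have aG: "a \<in> carrier G" using a(1) by (rule generate_in_carrier[rotated]) auto
      obtain l where l: "l \<in> B L" "l \<notin> J" using J by blast
      have "d n \<in> Q L l" if "n < L" for n
      proof -
        have "h n \<in> Q L l" unfolding Q_def using that by (intro generate.incl) auto
        moreover have "finprod G e (B n) \<in> Q L l"
          unfolding Q_def using B_disjoint[OF l(1), of n] that by (intro generate_mono[OF _ fin_in]) auto
        ultimately show ?thesis unfolding d_def Q_def by (intro generate_mult)
      qed
      moreover have "e j \<in> Q L l" if "j \<in> J" for j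
        unfolding Q_def using that l by (intro generate.incl) auto
      ultimately have "generate G (d ` {p..<L} \<union> e ` J) \<subseteq> Q L l"
        unfolding Q_def by (intro generate_subgroup_incl generate_is_subgroup sub) auto
      then have "a \<in> Q L l" using a(1) by blast
      moreover have "g \<in> Q L l"
        unfolding Q_def using True B_ge(2)[OF l(1)] by (intro generate_mono[OF _ g]) auto
      ultimately have "d L [^] c \<in> Q L l"
        unfolding Q_def a(2) using aG by - (rule generate_cancel_left[OF sub, of a], auto)
      then have "d L [^] c = \<one>" by (rule d_in_Q[OF l(1)])
      then have "g = a" using a(2) aG by simp
      then show ?thesis using a(1) Suc.IH by simp
    qed
  qed simp
  define u where "u m = (if even m then e (m div 2) else d (m div 2))" for m
  have uG: "u m \<in> carrier G" for m by (simp add: u_def)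
  have u_tail: "u ` {2 * m..} = e ` {m..} \<union> d ` {m..}" for m
  proof -
    have "u (2 * i) = e i" "u (Suc (2 * i)) = d i" for i by (simp_all add: u_def)
    then have "e i \<in> u ` {2 * m..}" "d i \<in> u ` {2 * m..}" if "m \<le> i" for i
      using that by (auto intro: image_eqI[of _ u "2 * i"] image_eqI[of _ u "Suc (2 * i)"])
    moreover have "u i \<in> e ` {m..} \<union> d ` {m..}" if "2 * m \<le> i" for i
      using that by (auto simp: u_def)
    ultimately show ?thesis by auto
  qed
  have not_one: "e m \<noteq> \<one>" for m
  proof
    assume "e m = \<one>"
    then have "e m [^] (1::int) \<in> generate G (e ` {})" by (simp add: generate_empty)
    then have "int N dvd 1" by (rule independent_dvd[OF e, rotated]) simp
    then show False using N by simp
  qed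
  have "\<exists>n\<ge>m. u n \<noteq> \<one>" for m
    using not_one[of m] by (intro exI[of _ "2 * m"]) (simp add: u_def)
  moreover have "\<exists>k. g \<notin> sequence_neighbourhood u k" if g: "g \<in> carrier G" "g \<noteq> \<one>" for g
  proof (cases "g \<in> generate G (h ` UNIV \<union> e ` UNIV)")
    case False
    have "d n \<in> generate G (h ` UNIV \<union> e ` UNIV)" for n
      unfolding d_def by (intro generate_mult generate_mono[OF _ fin_in[OF finB]] generate.incl) auto
    then have "range u \<subseteq> generate G (h ` UNIV \<union> e ` UNIV)"
      by (auto simp: u_def intro: generate.incl)
    then have "generate G (range u) \<subseteq> generate G (h ` UNIV \<union> e ` UNIV)"
      by (intro generate_subgroup_incl generate_is_subgroup sub)
    then have "g \<notin> sequence_neighbourhood u (\<lambda>_. 0)"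
      using False sequence_neighbourhood_const[of u 0, OF uG] by (auto simp: atLeast_0)
    then show ?thesis by blast
  next
    case True
    then obtain a b where ab: "a \<in> generate G (range h)" "b \<in> generate G (range e)" "g = a \<otimes> b"
      using generate_Un_iff[of "range h" "range e" g] sub by auto
    obtain I1 I2 where I: "finite I1" "a \<in> generate G (h ` I1)" "finite I2" "b \<in> generate G (e ` I2)"
      using generate_finite_support[OF ab(1)] generate_finite_support[OF ab(2)] by auto
    obtain q where q: "I1 \<union> I2 \<subseteq> {..<q}"
      using finite_nat_bounded[of "I1 \<union> I2"] I by auto
    have g_in: "g \<in> generate G (h ` {..p} \<union> e ` {..<p})" if "q \<le> p" for p
    proof -
      have "a \<in> generate G (h ` {..p} \<union> e ` {..<p})" "b \<in> generate G (h ` {..p} \<union> e ` {..<p})"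
        using q that by (auto intro!: generate_mono[OF _ I(2)] generate_mono[OF _ I(4)])
      then show ?thesis unfolding ab(3) by (intro generate_mult)
    qed
    have "\<exists>p\<ge>q. g \<notin> generate G (e ` {p..})"
    proof (cases "g \<in> generate G (range e)")
      case True
      then obtain I where I: "finite I" "g \<in> generate G (e ` I)"
        using generate_finite_support[OF True] by auto
      obtain r where r: "I \<subseteq> {..<r}" using finite_nat_bounded[OF I(1)] by (elim exE)
      have disj: "I \<inter> {max q r..} = {}" using r by fastforce
      have "g \<notin> generate G (e ` {max q r..})"
        using independent_disjoint[OF e I(1) disj I(2)] g(2) by (rule contrapos_nn[rotated])
      then show ?thesis by (intro exI[of _ "max q r"]) simp
    next
      case False
      then have "g \<notin> generate G (e ` {q..})"
        by (rule contrapos_nn) (rule generate_mono[rotated], assumption, blast)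
      then show ?thesis by (intro exI[of _ q]) simp
    qed
    then obtain p where p: "q \<le> p" "g \<notin> generate G (e ` {p..})" by blast
    \<comment> \<open>An upper bound for the indices in the block; the sums make k monotone and larger than
      the positions of the members of e belonging to the first blocks.\<close>
    define w where "w n = (\<Sum>j\<in>B n. j + 1)" for n
    define k where "k i = 2 * (p + (\<Sum>n\<le>i. w n))" for i
    define p' where "p' = p + w 0"
    have "mono k"
    proof (rule monoI)
      fix x y :: nat assume "x \<le> y"
      then have "(\<Sum>n\<le>x. w n) \<le> (\<Sum>n\<le>y. w n)" by (intro sum_mono2) auto
      then show "k x \<le> k y" by (simp add: k_def)
    qed
    have k_large: "2 * j < k n" if "j \<in> B n" for n j
    proof -
      have "j + 1 \<le> w n"
        unfolding w_def by (rule member_le_sum[OF that]) simp_all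
      also have "\<dots> \<le> (\<Sum>n\<le>n. w n)"
        by (rule member_le_sum) simp_all
      finally show ?thesis by (simp add: k_def)
    qed
    have "g \<notin> sequence_neighbourhood u k"
    proof
      assume "g \<in> sequence_neighbourhood u k"
      then obtain n where "g \<in> tail_products (\<lambda>m. if even m then e (m div 2) else d (m div 2)) k n"
        by (auto simp: sequence_neighbourhood_def u_def[abs_def])
      from tail_products_decomposition[OF _ _ \<open>mono k\<close> _ this, of p'] obtain J L where
        J: "J \<subseteq> {p'..}" "g \<in> generate G (d ` {p'..<L} \<union> e ` J)"
          "\<And>t. card (J \<inter> {j. 2 * j < k t}) \<le> t" "finite J"
        by (auto simp: k_def p'_def)
      have BJ: "\<not> B n \<subseteq> J" for n
      proof
        assume "B n \<subseteq> J"
        then have "B n \<subseteq> J \<inter> {j. 2 * j < k n}" using k_large by auto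
        then have "card (B n) \<le> card (J \<inter> {j. 2 * j < k n})" using J(4) by (intro card_mono) auto
        then show False using cardB[of n] J(3)[of n] by simp
      qed
      have "g \<in> generate G (h ` {..p'} \<union> e ` {..<p'})"
        using p(1) by (intro g_in) (simp add: p'_def)
      then have "g \<in> generate G (e ` J)" by (rule peel[OF _ BJ J(2)])
      then have "g \<in> generate G (e ` {p..})" by (rule generate_mono[rotated]) (use J(1) in \<open>auto simp: p'_def\<close>)
      with p(2) show False by simp
    qed
    then show ?thesis by blast
  qed
  moreover have "(\<Inter>m. generate G (u ` {m..})) = H"
  proof (intro equalityI subsetI)
    fix x assume x: "x \<in> (\<Inter>m. generate G (u ` {m..}))"
    have "x \<in> generate G (H \<union> e ` {m..})" for m
    proof -
      have sub': "H \<union> e ` {m..} \<subseteq> carrier G" using HG by auto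
      have "d n \<in> generate G (H \<union> e ` {m..})" if "m \<le> n" for n
      proof -
        have "B n \<subseteq> {m..}"
        proof
          fix j assume "j \<in> B n"
          then show "j \<in> {m..}" using B_ge(2)[of j n] that by simp
        qed
        then show ?thesis unfolding d_def using hH
          by (intro generate_mult generate_mono[OF _ fin_in[OF finB]] generate.incl) auto
      qed
      then have "u ` {2 * m..} \<subseteq> generate G (H \<union> e ` {m..})"
        unfolding u_tail by (auto intro: generate.incl)
      then have "generate G (u ` {2 * m..}) \<subseteq> generate G (H \<union> e ` {m..})"
        by (intro generate_subgroup_incl generate_is_subgroup sub')
      then show ?thesis using x by blast
    qed
    then show "x \<in> H" using eH by blast
  next
    fix x assume "x \<in> H"
    have "x \<in> generate G (u ` {m..})" for m
    proof -
      obtain n where n: "n \<ge> m" "h n = x" using h_often[OF \<open>x \<in> H\<close>] by blast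
      have "d n \<in> generate G (u ` {2 * m..})" "finprod G e (B n) \<in> generate G (u ` {2 * m..})"
      proof -
        have "B n \<subseteq> {m..}"
        proof
          fix j assume "j \<in> B n"
          then show "j \<in> {m..}" using B_ge(2)[of j n] n(1) by simp
        qed
        then show "finprod G e (B n) \<in> generate G (u ` {2 * m..})"
          unfolding u_tail by (intro generate_mono[OF _ fin_in[OF finB]]) auto
        show "d n \<in> generate G (u ` {2 * m..})"
          unfolding u_tail using n(1) by (intro generate.incl) auto
      qed
      then have "finprod G e (B n) \<in> generate G (u ` {2 * m..})"
        "x \<otimes> finprod G e (B n) \<in> generate G (u ` {2 * m..})"
        by (simp_all only: d_def n(2))
      moreover have "u ` {2 * m..} \<subseteq> carrier G" using uG by blast
      moreover have "x \<in> carrier G" using \<open>x \<in> H\<close> HG by blast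
      ultimately have "x \<in> generate G (u ` {2 * m..})" by - (rule generate_cancel_right)
      then show ?thesis by (rule generate_mono[rotated]) auto
    qed
    then show "x \<in> (\<Inter>m. generate G (u ` {m..}))" by blast
  qed
  ultimately show ?thesis using uG by blast
qed

section \<open>Direct sums of cyclic groups inside bounded groups\<close>

lemma subgroup_gcd_pow:
  assumes F: "subgroup F G" and x: "x \<in> carrier G" "x [^] (c::int) \<in> F" "x [^] (d::int) \<in> F"
  shows "x [^] gcd c d \<in> F"
proof -
  obtain u v where "u * c + v * d = gcd c d" using bezout_int by blast
  then have "x [^] gcd c d = (x [^] c) [^] u \<otimes> (x [^] d) [^] v"
    using x(1) by (metis int_pow_mult int_pow_pow mult.commute)
  moreover have "(x [^] c) [^] u \<in> F" "(x [^] d) [^] v \<in> F"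
    using x by (auto intro: subgroup_int_pow_closed[OF F])
  ultimately show ?thesis by (simp add: subgroup.m_closed[OF F])
qed

text \<open>
  If \<open>M = p m\<close> and the \<open>p\<close>-torsion is finite, then \<open>x \<mapsto> x\<^sup>p\<close> maps the \<open>M\<close>-torsion to the
  \<open>m\<close>-torsion with finite fibres, so the \<open>m\<close>-torsion is infinite as well and induction applies.
\<close>

lemma infinite_prime_torsion:
  assumes A: "subgroup A G" and M: "(M::nat) > 0" and inf: "infinite {x \<in> A. x [^] M = \<one>}"
  shows "\<exists>p. prime p \<and> p dvd M \<and> infinite {x \<in> A. x [^] p = \<one>}"
  using M inf
proof (induction M rule: less_induct)
  case (less M)
  have AG: "x \<in> carrier G" if "x \<in> A" for x using that by (rule subgroup.mem_carrier[OF A])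
  have pow_A: "x [^] (n::nat) \<in> A" if "x \<in> A" for x n
    using subgroup_int_pow_closed[OF A that, of "int n"] by (simp add: int_pow_int)
  have "{x \<in> A. x [^] (1::nat) = \<one>} \<subseteq> {\<one>}" using AG by auto
  then have "finite {x \<in> A. x [^] (1::nat) = \<one>}" by (rule finite_subset) simp
  with less.prems(2) have "M \<noteq> 1" by (intro notI) simp
  then obtain p where p: "prime p" "p dvd M" using prime_factor_nat by blast
  then obtain m where m: "M = p * m" by (elim dvdE)
  show ?case
  proof (cases "finite {x \<in> A. x [^] p = \<one>}")
    case False
    with p show ?thesis by (intro exI[of _ p] conjI)
  next
    case True
    have "m < M" "m > 0" using m less.prems(1) prime_gt_1_nat[OF p(1)] by auto
    have "infinite {x \<in> A. x [^] m = \<one>}"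
    proof
      assume fin: "finite {x \<in> A. x [^] m = \<one>}"
      let ?T = "{x \<in> A. x [^] M = \<one>}"
      have "finite {x \<in> ?T. x [^] p = y}" for y
      proof (cases "{x \<in> ?T. x [^] p = y} = {}")
        case False
        then obtain x0 where x0: "x0 \<in> A" "x0 [^] p = y" by auto
        have "{x \<in> ?T. x [^] p = y} \<subseteq> (\<lambda>t. x0 \<otimes> t) ` {x \<in> A. x [^] p = \<one>}"
        proof
          fix x assume "x \<in> {x \<in> ?T. x [^] p = y}"
          then have x: "x \<in> A" "x [^] p = y" by auto
          have "inv x0 \<otimes> x \<in> A"
            using x x0 by (simp add: subgroup.m_closed[OF A] subgroup.m_inv_closed[OF A])
          moreover have "(inv x0 \<otimes> x) [^] p = \<one>"
          proof -
            have "(inv x0 \<otimes> x) [^] p = (inv x0) [^] p \<otimes> x [^] p"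
              by (rule pow_mult_distrib[OF m_comm]) (simp_all add: AG[OF x(1)] AG[OF x0(1)])
            also have "\<dots> = inv (x0 [^] p) \<otimes> x0 [^] p"
              by (simp only: nat_pow_inv[OF AG[OF x0(1)]] x(2) x0(2))
            also have "\<dots> = \<one>" using AG[OF x0(1)] by simp
            finally show ?thesis .
          qed
          moreover have "x = x0 \<otimes> (inv x0 \<otimes> x)" using x x0 AG by (simp add: m_assoc[symmetric])
          ultimately show "x \<in> (\<lambda>t. x0 \<otimes> t) ` {x \<in> A. x [^] p = \<one>}"
            by (intro image_eqI[of _ _ "inv x0 \<otimes> x"]) simp_all
        qed
        then show ?thesis by (rule finite_subset) (intro finite_imageI True)
      qed (simp only: finite.emptyI)
      moreover have "(\<lambda>x. x [^] p) ` ?T \<subseteq> {x \<in> A. x [^] m = \<one>}"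
        using AG pow_A by (auto simp: m nat_pow_pow)
      then have "finite ((\<lambda>x. x [^] p) ` ?T)" using fin by (rule finite_subset)
      ultimately have "finite (\<Union>y\<in>(\<lambda>x. x [^] p) ` ?T. {x \<in> ?T. x [^] p = y})" by (intro finite_UN_I)
      moreover have "?T \<subseteq> (\<Union>y\<in>(\<lambda>x. x [^] p) ` ?T. {x \<in> ?T. x [^] p = y})" by auto
      ultimately have "finite ?T" by (rule finite_subset[rotated])
      with less.prems(2) show False by (rule notE)
    qed
    then obtain q where "prime q" "q dvd m" "infinite {x \<in> A. x [^] q = \<one>}"
      using less.IH[OF \<open>m < M\<close> \<open>m > 0\<close>] by auto
    then show ?thesis using m by (intro exI[of _ q]) simp
  qed
qed

text \<open>
  For every prime power \<open>p\<^sup>a\<close> exactly dividing \<open>N\<close>, the elements of order \<open>p\<close> that are \<open>p\<^sup>a\<^sup>-\<^sup>1\<close>-th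
  powers of elements of order \<open>p\<^sup>a\<close> cannot be confined to a finite set. In a bounded group this is
  what the existence of a direct sum of infinitely many copies of the cyclic group of order \<open>N\<close> amounts to.
\<close>

definition prime_power_rich :: "nat \<Rightarrow> bool" where
  "prime_power_rich N \<longleftrightarrow> (\<forall>p F. prime p \<longrightarrow> p dvd N \<longrightarrow> finite F \<longrightarrow>
     (\<exists>z\<in>carrier G. z [^] (p ^ multiplicity p N) = \<one> \<and> z [^] (p ^ (multiplicity p N - 1)) \<notin> F))"

text \<open>
  A cyclic group of order \<open>N\<close> meets \<open>F\<close> trivially as soon as none of its subgroups of prime order
  lies in \<open>F\<close>, that is, \<open>x\<^bsup>N/p\<^esup> \<notin> F\<close> for all primes \<open>p\<close> dividing \<open>N\<close>. Take for each \<open>p\<close> an element \<open>z p\<close>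
  of \<open>p\<close>-power order with this property and multiply them: in the power \<open>N/p\<close> only \<open>z p\<close> survives.
\<close>

lemma exists_element_independent_of_finite_subgroup:
  assumes N: "N > 0" and rich: "prime_power_rich N" and F: "subgroup F G" "finite F"
  shows "\<exists>x\<in>carrier G. x [^] N = \<one> \<and> (\<forall>c::int. x [^] c \<in> F \<longrightarrow> int N dvd c)"
proof -
  let ?P = "prime_factors N"
  have P: "prime p" "p dvd N" if "p \<in> ?P" for p using that by auto
  have "\<forall>p\<in>?P. \<exists>z. z \<in> carrier G \<and> z [^] (p ^ multiplicity p N) = \<one> \<and> z [^] (p ^ (multiplicity p N - 1)) \<notin> F"
  proof
    fix p assume "p \<in> ?P"
    from rich[unfolded prime_power_rich_def, rule_format, OF P[OF this] F(2)]
    show "\<exists>z. z \<in> carrier G \<and> z [^] (p ^ multiplicity p N) = \<one> \<and> z [^] (p ^ (multiplicity p N - 1)) \<notin> F"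
      by (simp only: Bex_def)
  qed
  then obtain z where "\<forall>p\<in>?P. z p \<in> carrier G \<and> z p [^] (p ^ multiplicity p N) = \<one> \<and>
      z p [^] (p ^ (multiplicity p N - 1)) \<notin> F"
    by (elim bchoice[THEN exE])
  then have z: "z p \<in> carrier G" "z p [^] (p ^ multiplicity p N) = \<one>" "z p [^] (p ^ (multiplicity p N - 1)) \<notin> F"
    if "p \<in> ?P" for p using that by simp_all
  have z_pow: "z p [^] m = \<one>" if p: "p \<in> ?P" and dvd: "p ^ multiplicity p N dvd m" for p m
  proof -
    obtain k where "m = p ^ multiplicity p N * k" using dvd by (elim dvdE)
    then have "z p [^] m = (z p [^] (p ^ multiplicity p N)) [^] k" using z(1)[OF p] by (simp add: nat_pow_pow)
    then show ?thesis using z(2)[OF p] by simp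
  qed
  have prod_pow: "finprod G z Q \<in> carrier G \<and> finprod G z Q [^] m = \<one>"
    if "Q \<subseteq> ?P" "\<And>p. p \<in> Q \<Longrightarrow> p ^ multiplicity p N dvd m" for Q and m :: nat
  proof -
    have "z ` Q \<subseteq> {x \<in> carrier G. x [^] m = \<one>}" using that z(1) z_pow by auto
    then have "generate G (z ` Q) \<subseteq> {x \<in> carrier G. x [^] m = \<one>}"
      by (rule generate_subgroup_incl) (rule torsion_subgroup)
    moreover have "finprod G z Q \<in> generate G (z ` Q)"
      using that(1) z(1) finite_subset[OF that(1)] by (intro finprod_in_generate) auto
    ultimately have "finprod G z Q \<in> {x \<in> carrier G. x [^] m = \<one>}" by (rule subsetD)
    then show ?thesis by simp
  qed
  define x where "x = finprod G z ?P"
  have x: "x \<in> carrier G" "x [^] N = \<one>"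
    using prod_pow[of ?P N] by (auto simp: x_def multiplicity_dvd)
  have key: "x [^] (N div p) \<notin> F" if p: "prime p" "p dvd N" for p
  proof
    assume xF: "x [^] (N div p) \<in> F"
    have pP: "p \<in> ?P" using p N by (simp add: in_prime_factors_iff)
    define a where "a = multiplicity p N"
    have "a > 0" using p N by (simp add: a_def prime_multiplicity_gt_zero_iff)
    obtain r where r: "N = p ^ a * r" "\<not> p dvd r"
      using multiplicity_decompose'[of N p] N p(1) unfolding a_def by (metis not_prime_unit neq0_conv)
    have pa: "p ^ a = p * p ^ (a - 1)" using \<open>a > 0\<close> by (cases a) simp_all
    have Np: "N div p = p ^ (a - 1) * r"
      using prime_gt_0_nat[OF p(1)] by (simp add: r(1) pa)
    have w: "finprod G z (?P - {p}) \<in> carrier G \<and> finprod G z (?P - {p}) [^] (N div p) = \<one>"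
    proof (rule prod_pow)
      fix q assume q: "q \<in> ?P - {p}"
      then have "coprime (q ^ multiplicity q N) p"
        using p P[of q] by (auto intro!: primes_coprime simp: coprime_power_left_iff)
      moreover have "q ^ multiplicity q N dvd p * (N div p)"
        using p(2) by (simp add: multiplicity_dvd)
      ultimately show "q ^ multiplicity q N dvd N div p" by (simp add: coprime_dvd_mult_right_iff)
    qed auto
    have "finprod G z (insert p (?P - {p})) = z p \<otimes> finprod G z (?P - {p})"
      using z(1) pP by (intro finprod_insert) auto
    then have "x = z p \<otimes> finprod G z (?P - {p})" using pP by (simp add: x_def insert_absorb)
    then have "x [^] (N div p) = z p [^] (N div p)"
      using w z(1)[OF pP] by (simp add: pow_mult_distrib m_comm)
    also have "\<dots> = (z p [^] (p ^ (a - 1))) [^] r" using z(1)[OF pP] by (simp add: Np nat_pow_pow)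
    finally have 1: "(z p [^] (p ^ (a - 1))) [^] int r \<in> F" using xF by (simp add: int_pow_int)
    have "(z p [^] (p ^ (a - 1))) [^] p = z p [^] (p ^ a)"
      using z(1)[OF pP] by (simp add: nat_pow_pow pa mult.commute)
    then have 2: "(z p [^] (p ^ (a - 1))) [^] int p \<in> F"
      using z(2)[OF pP] subgroup.one_closed[OF F(1)] by (simp add: int_pow_int a_def)
    have "gcd (int r) (int p) = 1"
      using r(2) p(1) by (metis coprime_iff_gcd_eq_1 gcd.commute gcd_int_int_eq of_nat_1 prime_imp_coprime)
    then have "z p [^] (p ^ (a - 1)) \<in> F"
      using subgroup_gcd_pow[OF F(1) _ 1 2] z(1)[OF pP] by simp
    then show False using z(3)[OF pP] by (simp add: a_def)
  qed
  have "int N dvd c" if c: "x [^] c \<in> F" for c :: int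
  proof (rule ccontr)
    assume nd: "\<not> int N dvd c"
    define g where "g = nat (gcd c (int N))"
    have g: "int g = gcd c (int N)" by (simp add: g_def)
    have "x [^] int N \<in> F" using x(2) subgroup.one_closed[OF F(1)] by (simp add: int_pow_int)
    then have xg: "x [^] int g \<in> F" unfolding g using x(1) c by (intro subgroup_gcd_pow[OF F(1)])
    have "int g dvd int N" "int g dvd c" unfolding g by simp_all
    then obtain m where m: "N = g * m" by (auto simp: int_dvd_int_iff elim: dvdE)
    then have "m \<noteq> 1" using nd \<open>int g dvd c\<close> by auto
    then obtain p where p: "prime p" "p dvd m" using prime_factor_nat by blast
    then obtain k where k: "m = p * k" by (elim dvdE)
    have "N div p = g * k" using prime_gt_0_nat[OF p(1)] by (simp add: m k)
    then have "x [^] (N div p) = (x [^] int g) [^] int k"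
      using x(1) by (simp add: nat_pow_pow int_pow_int)
    then have "x [^] (N div p) \<in> F" using subgroup_int_pow_closed[OF F(1) xg] by simp
    moreover have "p dvd N" using p(2) m by simp
    ultimately show False using key[OF p(1)] by simp
  qed
  with x show ?thesis by (intro bexI[of _ x] conjI allI impI)
qed

lemma exists_triangular_sequence:
  assumes exp: "M > 0" "\<And>x. x \<in> carrier G \<Longrightarrow> x [^] (M::nat) = \<one>"
    and N: "N > 0" and rich: "prime_power_rich N"
  shows "\<exists>x::nat \<Rightarrow> 'a. \<forall>n. x n \<in> carrier G \<and> x n [^] N = \<one> \<and>
    (\<forall>c::int. x n [^] c \<in> generate G (x ` {..<n}) \<longrightarrow> int N dvd c)"
proof (rule dependent_wellorder_choice[where P = "\<lambda>x n r. r \<in> carrier G \<and> r [^] N = \<one> \<and>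
    (\<forall>c::int. r [^] c \<in> generate G (x ` {..<n}) \<longrightarrow> int N dvd c)"])
  fix r and f g :: "nat \<Rightarrow> 'a" and n :: nat
  assume "\<And>y. y < n \<Longrightarrow> f y = g y"
  then have "f ` {..<n} = g ` {..<n}" by (intro image_cong) auto
  then show "(r \<in> carrier G \<and> r [^] N = \<one> \<and> (\<forall>c::int. r [^] c \<in> generate G (f ` {..<n}) \<longrightarrow> int N dvd c)) =
    (r \<in> carrier G \<and> r [^] N = \<one> \<and> (\<forall>c::int. r [^] c \<in> generate G (g ` {..<n}) \<longrightarrow> int N dvd c))"
    by (simp only:)
next
  fix n :: nat and f :: "nat \<Rightarrow> 'a"
  assume f: "\<And>y. y < n \<Longrightarrow> f y \<in> carrier G \<and> f y [^] N = \<one> \<and>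
    (\<forall>c::int. f y [^] c \<in> generate G (f ` {..<y}) \<longrightarrow> int N dvd c)"
  then have sub: "f ` {..<n} \<subseteq> carrier G" by auto
  have "finite (generate G (f ` {..<n}))" using sub exp by (intro finite_generate) auto
  from exists_element_independent_of_finite_subgroup[OF N rich generate_is_subgroup[OF sub] this]
  show "\<exists>r. r \<in> carrier G \<and> r [^] N = \<one> \<and> (\<forall>c::int. r [^] c \<in> generate G (f ` {..<n}) \<longrightarrow> int N dvd c)"
    by (simp only: Bex_def)
qed

text \<open>
  A non-zero vector of exponents has a last non-zero entry, and triangularity forces this entry to
  be divisible by \<open>N\<close>. So the canonical homomorphism from the direct sum is injective.
\<close>

lemma triangular_sequence_spans_direct_sum:
  fixes x :: "nat \<Rightarrow> 'a"
  assumes N: "N > 0" and x: "\<And>n. x n \<in> carrier G" "\<And>n. x n [^] N = \<one>"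
    "\<And>n c::int. x n [^] c \<in> generate G (x ` {..<n}) \<Longrightarrow> int N dvd c"
  shows "\<exists>K. subgroup K G \<and> G\<lparr>carrier := K\<rparr> \<cong> cyclic_group_power N"
proof -
  let ?C = "cyclic_group_power N"
  have C_group: "group ?C" by (simp add: cyclic_group_power_def)
  have hom_x: "(\<lambda>a. x i [^] a) \<in> hom (integer_mod_group N) G" for i
  proof (rule homI)
    fix a b :: int
    have "x i [^] int N = \<one>" using x(2) by (simp add: int_pow_int)
    have "x i [^] ((a + b) mod int N) = x i [^] ((a + b) mod int N) \<otimes> (x i [^] int N) [^] ((a + b) div int N)"
      using x(1) \<open>x i [^] int N = \<one>\<close> by simp
    also have "\<dots> = x i [^] ((a + b) mod int N + int N * ((a + b) div int N))"
      using x(1) by (simp only: int_pow_pow int_pow_mult)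
    also have "\<dots> = x i [^] a \<otimes> x i [^] b" using x(1) by (simp add: int_pow_mult)
    finally show "x i [^] (a \<otimes>\<^bsub>integer_mod_group N\<^esub> b) = x i [^] a \<otimes> x i [^] b" by simp
  qed (use x(1) in simp)
  define f where "f v = gfinprod G (\<lambda>i. x i [^] v i) UNIV" for v :: "nat \<Rightarrow> int"
  have "(\<lambda>v. gfinprod G (\<lambda>i. x i [^] v i) UNIV) \<in> hom (sum_group UNIV (\<lambda>_. integer_mod_group N)) G"
    using hom_x by (intro hom_group_sum) auto
  then have f_hom: "f \<in> hom ?C G" by (simp add: f_def[abs_def] cyclic_group_power_def)
  interpret f: group_hom ?C G f
    using f_hom C_group by (simp add: group_hom_def group_hom_axioms_def is_group)
  have "v = \<one>\<^bsub>?C\<^esub>" if v: "v \<in> carrier ?C" "f v = \<one>" for v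
  proof (rule ccontr)
    assume nv: "v \<noteq> \<one>\<^bsub>?C\<^esub>"
    define S where "S = {i. v i \<noteq> 0}"
    have "finite S" and range: "\<And>i. 0 \<le> v i \<and> v i < int N"
      using v(1) N by (auto simp: S_def cyclic_group_power_def carrier_sum_group PiE_iff carrier_integer_mod_group)
    have "S \<noteq> {}"
    proof
      assume "S = {}"
      then have "v = (\<lambda>_. 0)" by (auto simp: S_def)
      then show False using nv by (simp add: cyclic_group_power_def restrict_def)
    qed
    define n where "n = Max S"
    have n: "n \<in> S" "S - {n} \<subseteq> {..<n}"
      using \<open>finite S\<close> \<open>S \<noteq> {}\<close> Max_ge[OF \<open>finite S\<close>] by (auto simp: n_def less_le)
    let ?t = "\<lambda>i. x i [^] v i"
    have "f v = gfinprod G ?t S"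
      unfolding f_def by (rule gfinprod_mono_neutral_cong_right) (use x(1) in \<open>auto simp: S_def\<close>)
    also have "\<dots> = finprod G ?t S" using \<open>finite S\<close> x(1) by (intro gfinprod_eq_finprod) auto
    also have "\<dots> = finprod G ?t (insert n (S - {n}))" using n(1) by (simp add: insert_absorb)
    also have "\<dots> = ?t n \<otimes> finprod G ?t (S - {n})"
      using \<open>finite S\<close> x(1) by (intro finprod_insert) auto
    finally have one: "?t n \<otimes> finprod G ?t (S - {n}) = \<one>" using v(2) by simp
    have sub: "x ` {..<n} \<subseteq> carrier G" using x(1) by auto
    have "?t ` (S - {n}) \<subseteq> generate G (x ` {..<n})"
      by (intro image_subsetI generate_int_pow[OF sub] generate.incl imageI) (use n(2) in auto)
    then have "generate G (?t ` (S - {n})) \<subseteq> generate G (x ` {..<n})"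
      by (rule generate_subgroup_incl) (rule generate_is_subgroup[OF sub])
    moreover have "finprod G ?t (S - {n}) \<in> generate G (?t ` (S - {n}))"
      using \<open>finite S\<close> x(1) by (intro finprod_in_generate) auto
    ultimately have mem: "finprod G ?t (S - {n}) \<in> generate G (x ` {..<n})" by (rule subsetD)
    moreover have "?t n = inv (finprod G ?t (S - {n}))"
      using one x(1) generate_in_carrier[OF sub mem] by (intro inv_equality[symmetric]) auto
    ultimately have "?t n \<in> generate G (x ` {..<n})" by (simp add: generate_inv[OF sub])
    then have "int N dvd v n" by (rule x(3))
    then have "v n = 0" using range[of n] by (metis zdvd_not_zless order_le_less)
    then show False using n(1) by (simp add: S_def)
  qed
  then have inj: "inj_on f (carrier ?C)" by (simp add: f.inj_on_one_iff)
  have K: "subgroup (f ` carrier ?C) G" by (rule f.img_is_subgroup)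
  have "f \<in> iso ?C (G\<lparr>carrier := f ` carrier ?C\<rparr>)"
    using inj f_hom by (auto simp: iso_def hom_def bij_betw_def)
  then have "?C \<cong> G\<lparr>carrier := f ` carrier ?C\<rparr>" by (auto simp: is_iso_def)
  then have "G\<lparr>carrier := f ` carrier ?C\<rparr> \<cong> ?C" by (rule group.iso_sym[OF C_group])
  with K show ?thesis by (intro exI[of _ "f ` carrier ?C"] conjI)
qed

proposition direct_sum_subgroup_if_prime_power_rich:
  assumes "M > 0" "\<And>x. x \<in> carrier G \<Longrightarrow> x [^] (M::nat) = \<one>" "N > 0" "prime_power_rich N"
  shows "\<exists>K. subgroup K G \<and> G\<lparr>carrier := K\<rparr> \<cong> cyclic_group_power N"
proof -
  obtain x :: "nat \<Rightarrow> 'a" where "\<forall>n. x n \<in> carrier G \<and> x n [^] N = \<one> \<and>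
    (\<forall>c::int. x n [^] c \<in> generate G (x ` {..<n}) \<longrightarrow> int N dvd c)"
    using exists_triangular_sequence[OF assms] by auto
  then show ?thesis by (intro triangular_sequence_spans_direct_sum[OF assms(3), of x]) simp_all
qed

section \<open>Exponents of von Neumann radicals\<close>

text \<open>
  The map \<open>x \<mapsto> x\<^sup>m\<close> is continuous with finite image in a Hausdorff space, so \<open>x\<^sup>m = \<one>\<close> near \<open>\<one>\<close>. Hence
  \<open>x \<mapsto> \<phi> (x\<^sup>m)\<close> is a continuous character for every character \<open>\<phi>\<close>, continuous or not, and these
  suffice to detect \<open>h\<^sup>m \<noteq> \<one>\<close>.
\<close>

lemma radical_pow_eq_one:
  assumes exp: "M > 0" "\<And>x. x \<in> carrier G \<Longrightarrow> x [^] (M::nat) = \<one>"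
    and T: "topological_abelian_group G T" "Hausdorff_space T"
    and fin: "finite ((\<lambda>x. x [^] m) ` carrier G)"
    and h: "h \<in> von_neumann_radical G T"
  shows "h [^] (m::nat) = \<one>"
proof (rule ccontr)
  assume nh: "h [^] m \<noteq> \<one>"
  have ts: "topspace T = carrier G" and mult: "continuous_map (prod_topology T T) T (\<lambda>(x, y). x \<otimes> y)"
    using T(1) by (auto simp: topological_abelian_group_def)
  have trivial: "(\<lambda>_. 1) \<in> continuous_characters G T"
    by (auto simp: continuous_characters_def hom_def)
  have hG: "h \<in> carrier G" using h trivial unfolding von_neumann_radical_def kernel_def by blast
  have pow_cont: "continuous_map T T (\<lambda>x. x [^] n)" for n :: nat
  proof (induction n)
    case 0
    show ?case by (simp add: ts)
  next
    case (Suc n)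
    have "continuous_map T T ((\<lambda>(x, y). x \<otimes> y) \<circ> (\<lambda>x. (x [^] n, x)))"
      using Suc by (intro continuous_map_compose[OF _ mult]) (simp add: continuous_map_paired)
    then show ?case by (simp add: o_def)
  qed
  define R where "R = (\<lambda>x. x [^] m) ` carrier G - {\<one>}"
  have "closedin T R"
    by (rule closedin_Hausdorff_finite[OF T(2)]) (use fin in \<open>auto simp: R_def ts\<close>)
  then have "openin T (carrier G - R)" using ts by (metis openin_diff openin_topspace)
  from openin_continuous_map_preimage[OF pow_cont[of m] this]
  have W: "openin T {x \<in> carrier G. x [^] m \<in> carrier G - R}" by (simp add: ts)
  from exists_separating_character[OF exp triv_subgroup nat_pow_closed[OF hG, of m]] nh
  obtain \<phi> where \<phi>: "\<phi> \<in> hom G circle_group" "\<phi> (h [^] m) \<noteq> 1" by auto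
  interpret \<phi>: group_hom G circle_group \<phi>
    using \<phi>(1) comm_group_circle_group by (simp add: group_hom_def group_hom_axioms_def comm_group_def is_group)
  have "(\<lambda>x. \<phi> (x [^] m)) \<in> hom G circle_group"
  proof (rule homI)
    fix x y assume xy: "x \<in> carrier G" "y \<in> carrier G"
    show "\<phi> (x [^] m) \<in> carrier circle_group" using xy by (intro \<phi>.hom_closed) simp
    show "\<phi> ((x \<otimes> y) [^] m) = \<phi> (x [^] m) \<otimes>\<^bsub>circle_group\<^esub> \<phi> (y [^] m)"
      using xy \<phi>.hom_mult[of "x [^] m" "y [^] m"] by (simp add: pow_mult_distrib m_comm)
  qed
  then have "(\<lambda>x. \<phi> (x [^] m)) \<in> continuous_characters G T"
  proof (rule continuous_hom_if_trivial_nearby[OF T(1) _ W])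
    show "\<one> \<in> {x \<in> carrier G. x [^] m \<in> carrier G - R}" by (simp add: R_def)
    show "\<phi> (w [^] m) = 1" if "w \<in> {x \<in> carrier G. x [^] m \<in> carrier G - R}" for w
      using that \<phi>.hom_one by (auto simp: R_def)
  qed
  then have "h \<in> kernel G circle_group (\<lambda>x. \<phi> (x [^] m))"
    using h by (auto simp: von_neumann_radical_def)
  then show False using \<phi>(2) by (simp add: kernel_def)
qed

lemma power_image_subgroup: "subgroup ((\<lambda>x. x [^] (m::nat)) ` carrier G) G"
proof (rule subgroupI)
  show "inv a \<in> (\<lambda>x. x [^] m) ` carrier G" if "a \<in> (\<lambda>x. x [^] m) ` carrier G" for a
    using that by (auto simp: nat_pow_inv[symmetric])
  show "a \<otimes> b \<in> (\<lambda>x. x [^] m) ` carrier G" if ab: "a \<in> (\<lambda>x. x [^] m) ` carrier G" "b \<in> (\<lambda>x. x [^] m) ` carrier G" for a b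
  proof -
    obtain x y where "x \<in> carrier G" "y \<in> carrier G" "a = x [^] m" "b = y [^] m"
      using ab by blast
    then show ?thesis by (intro image_eqI[of _ _ "x \<otimes> y"]) (simp_all add: pow_mult_distrib m_comm)
  qed
qed auto

text \<open>
  Let \<open>p\<^sup>a\<close> divide \<open>N\<close> exactly and let \<open>q\<close> be the part of the exponent of the group prime to \<open>p\<close>. Since \<open>N\<close>
  does not divide \<open>m = q p\<^sup>a\<^sup>-\<^sup>1\<close>, some element of the radical has a non-trivial \<open>m\<close>-th power, so the
  group of \<open>m\<close>-th powers is infinite. It is a bounded \<open>p\<close>-group, hence has infinitely many elements
  \<open>y\<^sup>m\<close> of order dividing \<open>p\<close>, and \<open>y\<^sup>q\<close> is the required element.
\<close>

lemma prime_power_rich_if_radical: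
  assumes exp: "M > 0" "\<And>x. x \<in> carrier G \<Longrightarrow> x [^] (M::nat) = \<one>"
    and T: "topological_abelian_group G T" "Hausdorff_space T"
    and N: "N > 0" "\<And>m. (\<And>h. h \<in> von_neumann_radical G T \<Longrightarrow> h [^] (m::nat) = \<one>) \<Longrightarrow> N dvd m"
  shows "prime_power_rich N"
  unfolding prime_power_rich_def
proof (intro allI impI)
  fix p and F :: "'a set" assume p: "prime p" "p dvd N" and F: "finite F"
  define a where "a = multiplicity p N"
  have "a > 0" using p N(1) by (simp add: a_def prime_multiplicity_gt_zero_iff)
  then have pa: "p ^ a = p ^ (a - 1) * p" by (cases a) simp_all
  define b where "b = multiplicity p M"
  obtain q where q: "M = p ^ b * q" "\<not> p dvd q"
    using multiplicity_decompose'[of M p] exp(1) p(1) unfolding b_def by (metis not_prime_unit neq0_conv)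
  define m where "m = q * p ^ (a - 1)"
  let ?A = "(\<lambda>x. x [^] m) ` carrier G"
  have "infinite ?A"
  proof
    assume "finite ?A"
    then have "N dvd m" by (intro N(2) radical_pow_eq_one[OF exp T])
    moreover have "p ^ a dvd N" by (simp add: a_def multiplicity_dvd)
    ultimately have "p * p ^ (a - 1) dvd q * p ^ (a - 1)"
      unfolding m_def pa by (metis dvd_trans mult.commute)
    then show False using q(2) prime_gt_0_nat[OF p(1)] by simp
  qed
  moreover have "?A \<subseteq> {x \<in> ?A. x [^] (p ^ b) = \<one>}"
  proof
    fix y assume "y \<in> ?A"
    then obtain x where x: "x \<in> carrier G" "y = x [^] m" by blast
    have "m * p ^ b = M * p ^ (a - 1)" by (simp add: m_def q(1))
    then have "y [^] (p ^ b) = (x [^] M) [^] (p ^ (a - 1))" using x by (simp add: nat_pow_pow)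
    then show "y \<in> {x \<in> ?A. x [^] (p ^ b) = \<one>}" using x exp by auto
  qed
  ultimately have "infinite {x \<in> ?A. x [^] (p ^ b) = \<one>}" by (rule infinite_super[rotated])
  then obtain p' where p': "prime p'" "p' dvd p ^ b" "infinite {x \<in> ?A. x [^] p' = \<one>}"
    using infinite_prime_torsion[OF power_image_subgroup, of "p ^ b" m] prime_gt_0_nat[OF p(1)] by auto
  have "p' dvd p" using p'(1,2) by (rule prime_dvd_power)
  then have "p' = p" using p'(1) p(1) by (intro primes_dvd_imp_eq)
  have "\<not> {x \<in> ?A. x [^] p = \<one>} \<subseteq> F"
  proof
    assume "{x \<in> ?A. x [^] p = \<one>} \<subseteq> F"
    then have "finite {x \<in> ?A. x [^] p = \<one>}" using F by (rule finite_subset)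
    then show False using p'(3) \<open>p' = p\<close> by simp
  qed
  then obtain y where y: "y \<in> carrier G" "(y [^] m) [^] p = \<one>" "y [^] m \<notin> F" by auto
  have "(y [^] q) [^] (p ^ a) = (y [^] m) [^] p"
    using y(1) by (simp add: nat_pow_pow m_def pa mult.assoc)
  moreover have "(y [^] q) [^] (p ^ (a - 1)) = y [^] m"
    using y(1) by (simp add: nat_pow_pow m_def)
  ultimately show "\<exists>z\<in>carrier G. z [^] (p ^ multiplicity p N) = \<one> \<and> z [^] (p ^ (multiplicity p N - 1)) \<notin> F"
    using y by (intro bexI[of _ "y [^] q"]) (simp_all add: a_def[symmetric])
qed

lemma infinite_imp_prime_power_rich_prime:
  assumes exp: "M > 0" "\<And>x. x \<in> carrier G \<Longrightarrow> x [^] (M::nat) = \<one>" and inf: "infinite (carrier G)"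
  shows "\<exists>p. prime p \<and> prime_power_rich p"
proof -
  have "{x \<in> carrier G. x [^] M = \<one>} = carrier G" using exp by auto
  then obtain p :: nat where p: "prime p" "infinite {x \<in> carrier G. x [^] p = \<one>}"
    using infinite_prime_torsion[OF subgroup_self exp(1)] inf by auto
  have "prime_power_rich p"
    unfolding prime_power_rich_def
  proof (intro allI impI)
    fix q and F :: "'a set" assume "prime q" "q dvd p" "finite F"
    then have "q = p" using p(1) by (simp add: primes_dvd_imp_eq)
    have "multiplicity p p = 1" using p(1) by (intro multiplicity_self) auto
    moreover have "\<not> {x \<in> carrier G. x [^] p = \<one>} \<subseteq> F"
      using p(2) finite_subset[OF _ \<open>finite F\<close>] by (rule contrapos_nn)
    ultimately show "\<exists>z\<in>carrier G. z [^] (q ^ multiplicity q p) = \<one> \<and> z [^] (q ^ (multiplicity q p - 1)) \<notin> F"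
      unfolding \<open>q = p\<close> by auto
  qed
  with p(1) show ?thesis by (intro exI[of _ p] conjI)
qed

proposition radical_of_complete_topology:
  assumes exp: "M > 0" "\<And>x. x \<in> carrier G \<Longrightarrow> x [^] (M::nat) = \<one>"
    and H: "subgroup H G" "countable H" "\<And>h. h \<in> H \<Longrightarrow> h [^] N = \<one>"
    and N: "N \<ge> 2" and K: "subgroup K G" "G\<lparr>carrier := K\<rparr> \<cong> cyclic_group_power N"
  shows "H \<in> NRC G"
proof -
  obtain e0 where "independent_sequence N e0" using independent_sequence_of_iso[OF K] by (elim exE)
  from independent_modulo_countable_subgroup[OF this exp H(1,2)]
  obtain e where e: "independent_sequence N e" "(\<Inter>m. generate G (H \<union> e ` {m..})) = H" by auto
  from exists_null_sequence_with_radical[OF exp H N e]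
  obtain u where u: "\<forall>n. u n \<in> carrier G" "\<forall>m. \<exists>n\<ge>m. u n \<noteq> \<one>"
    "\<forall>g\<in>carrier G. g \<noteq> \<one> \<longrightarrow> (\<exists>k. g \<notin> sequence_neighbourhood u k)"
    "(\<Inter>m. generate G (u ` {m..})) = H" by auto
  have uG: "u n \<in> carrier G" for n using u(1) by simp
  show ?thesis
    unfolding NRC_def
  proof (intro CollectI conjI exI[of _ "sequence_topology u"])
    show "topological_abelian_group G (sequence_topology u)"
      by (rule topological_abelian_group_sequence_topology[of u, OF uG])
    show "Hausdorff_space (sequence_topology u)"
      using u(3) by (intro Hausdorff_sequence_topology[of u, OF uG]) simp
    show "complete_group_topology G (sequence_topology u)"
      by (rule complete_sequence_topology[of u, OF uG])
    show "sequence_topology u \<noteq> discrete_topology (carrier G)"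
      using u(2) by (intro sequence_topology_not_discrete[of u, OF uG]) simp
    show "von_neumann_radical G (sequence_topology u) = H"
      using von_neumann_radical_sequence_topology[of u, OF uG exp] u(4) by simp
  qed (rule H(1))
qed

end

section \<open>The characterization of radicals\<close>

theorem theorem2:
  fixes G :: "('a, 'b) monoid_scheme" and H :: "'a set"
  assumes "comm_group G"
    and "infinite (carrier G)"
    and "bounded_group G"
    and "subgroup H G"
    and "countable H"
  shows "((\<exists>K. subgroup K G \<and>
              G\<lparr>carrier := K\<rparr> \<cong> cyclic_group_power (group_exp (G\<lparr>carrier := H\<rparr>)))
            \<longleftrightarrow> H \<in> NRC G) \<and>
         (H \<in> NRC G \<longleftrightarrow> H \<in> NR G)"
proof -
  interpret comm_group G by fact
  define M where "M = group_exp G"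
  define N where "N = group_exp (G\<lparr>carrier := H\<rparr>)"
  have M: "M > 0" using assms(3) by (simp add: bounded_group_def M_def)
  have exp: "x [^]\<^bsub>G\<^esub> M = \<one>\<^bsub>G\<^esub>" if "x \<in> carrier G" for x
    using group_exp_dvd_iff[OF is_group, of M] that by (simp add: M_def)
  have HG: "h \<in> carrier G" if "h \<in> H" for h using assms(4) that by (rule subgroup.mem_carrier)
  have N_dvd: "N dvd m \<longleftrightarrow> (\<forall>h\<in>H. h [^]\<^bsub>G\<^esub> m = \<one>\<^bsub>G\<^esub>)" for m
    using group_exp_dvd_iff[OF subgroup_imp_group[OF assms(4)], of m]
    by (simp add: N_def nat_pow_consistent[symmetric])
  then have "N dvd M" using exp HG by simp
  then have N: "N > 0" using M by (intro Nat.gr0I) auto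
  have N_pow: "h [^]\<^bsub>G\<^esub> N = \<one>\<^bsub>G\<^esub>" if "h \<in> H" for h using N_dvd[of N] that by simp
  let ?K = "\<exists>K. subgroup K G \<and> G\<lparr>carrier := K\<rparr> \<cong> cyclic_group_power N"
  have "H \<in> NRC G" if ?K
  proof (cases "N = 1")
    case False
    then have "N \<ge> 2" using N by simp
    obtain K where "subgroup K G" "G\<lparr>carrier := K\<rparr> \<cong> cyclic_group_power N" using \<open>?K\<close> by (elim exE conjE)
    then show ?thesis
      by - (rule radical_of_complete_topology[OF M exp assms(4,5) N_pow \<open>N \<ge> 2\<close>])
  next
    case True
    obtain p where p: "prime p" "prime_power_rich p"
      using infinite_imp_prime_power_rich_prime[OF M exp assms(2)] by auto
    have "h [^]\<^bsub>G\<^esub> p = \<one>\<^bsub>G\<^esub>" if "h \<in> H" for h using N_pow[OF that] HG[OF that] True by simp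
    moreover obtain K where "subgroup K G" "G\<lparr>carrier := K\<rparr> \<cong> cyclic_group_power p"
      using direct_sum_subgroup_if_prime_power_rich[OF M exp prime_gt_0_nat[OF p(1)] p(2)] by auto
    ultimately show ?thesis
      by (intro radical_of_complete_topology[OF M exp assms(4,5) _ prime_ge_2_nat[OF p(1)]])
  qed
  moreover have "H \<in> NR G" if "H \<in> NRC G"
    using that unfolding NR_def NRC_def by auto
  moreover have ?K if "H \<in> NR G"
  proof -
    obtain T where T: "topological_abelian_group G T" "Hausdorff_space T" "von_neumann_radical G T = H"
      using \<open>H \<in> NR G\<close> unfolding NR_def by auto
    have "prime_power_rich N"
      by (rule prime_power_rich_if_radical[OF M exp T(1,2) N]) (simp_all add: T(3) N_dvd)
    then show ?thesis by - (rule direct_sum_subgroup_if_prime_power_rich[OF M exp N])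
  qed
  ultimately show ?thesis unfolding N_def by (intro conjI iffI) (simp_all only:)
qed

end
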